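(* Let $\mathbb{F}_q$ be a finite field with $q$ elements, let $S=\mathbb{F}_q[t_1,\ldots,t_s]$, let $v_1,\ldots,v_s\in\mathbb{N}^n$, let $X\subset\mathbb{P}^{s-1}$ be the projective algebraic toric set over $\mathbb{F}_q$ parameterized by the monomials with exponent vectors $v_1,\ldots,v_s$, and let $I(X)\subset S$ be its vanishing ideal. Then $I(X)$ is a binomial set theoretic complete intersection; that is, there are binomials $g_1,\ldots,g_r\in S$, where $r$ is the height of $I(X)$, such that $\mathrm{rad}(I(X))=\mathrm{rad}(g_1,\ldots,g_r)$.
   Context: $\mathbb{N}$ denotes the nonnegative integers and $\mathbb{F}_q^*=\mathbb{F}_q\setminus\{0\}$. Writing $v_i=(v_{i1},\ldots,v_{in})$, $X=\{[(x_1^{v_{11}}\cdots x_n^{v_{1n}},\ldots,x_1^{v_{s1}}\cdots x_n^{v_{sn}})]\mid x_i\in\mathbb{F}_q^*\text{ for all }i\}\subset\mathbb{P}^{s-1}$, where $\mathbb{P}^{s-1}$ is the projective space over $\mathbb{F}_q$. The vanishing ideal $I(X)$ is the ideal of $S$ generated by the homogeneous polynomials (standard grading, $\deg t_i=1$) that vanish on $X$. A binomial is a polynomial of the form $t^a-t^b$ with $a,b\in\mathbb{N}^s$, where $t^a=t_1^{a_1}\cdots t_s^{a_s}$. $\mathrm{rad}$ denotes the radical of an ideal. *)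

theory Defs
  imports
    "HOL-Analysis.Analysis"
    "HOL-Algebra.Algebraic_Closure_Type"
    "HOL-Library.Poly_Mapping"
    "HOL-Library.Extended_Nat"
begin

section \<open>Radical and height of an ideal\<close>

definition rad_ideal :: "('b, 'c) ring_scheme \<Rightarrow> 'b set \<Rightarrow> 'b set" where
  "rad_ideal R I = {a \<in> carrier R. \<exists>k::nat. k > 0 \<and> a [^]\<^bsub>R\<^esub> k \<in> I}"

definition prime_chain :: "('b, 'c) ring_scheme \<Rightarrow> nat \<Rightarrow> (nat \<Rightarrow> 'b set) \<Rightarrow> bool" where
  "prime_chain R k P \<longleftrightarrow> (\<forall>i\<le>k. primeideal (P i) R) \<and> (\<forall>i<k. P i \<subset> P (Suc i))"

definition prime_height :: "('b, 'c) ring_scheme \<Rightarrow> 'b set \<Rightarrow> enat" where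
  "prime_height R p = Sup {enat k | k. \<exists>P. prime_chain R k P \<and> P k = p}"

definition ideal_height :: "('b, 'c) ring_scheme \<Rightarrow> 'b set \<Rightarrow> enat" where
  "ideal_height R I = Inf {prime_height R p | p. primeideal p R \<and> I \<subseteq> p}"


section \<open>Polynomials\<close>

text \<open>
  The polynomial ring \<open>S = K[t\<^sub>1,\<dots>,t\<^sub>s]\<close> with the variables indexed by a finite type
  \<open>'s\<close> of cardinality \<open>s\<close>: finitely supported maps from exponent vectors to coefficients.
\<close>

type_synonym ('s, 'a) mvpoly = "('s \<Rightarrow>\<^sub>0 nat) \<Rightarrow>\<^sub>0 'a"

abbreviation mvpoly_ring :: "('s, 'a::comm_ring_1) mvpoly ring" where
  "mvpoly_ring \<equiv> ring_of_type_algebra"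

definition mv_monom :: "('s \<Rightarrow>\<^sub>0 nat) \<Rightarrow> ('s, 'a::comm_ring_1) mvpoly" where
  "mv_monom a = Poly_Mapping.single a 1"

definition mv_eval :: "('s::finite, 'a::comm_ring_1) mvpoly \<Rightarrow> 'a ^ 's \<Rightarrow> 'a" where
  "mv_eval f x =
     (\<Sum>a\<in>Poly_Mapping.keys f. Poly_Mapping.lookup f a * (\<Prod>i\<in>UNIV. (x $ i) ^ Poly_Mapping.lookup a i))"

definition mv_homogeneous :: "('s::finite, 'a::comm_ring_1) mvpoly \<Rightarrow> bool" where
  "mv_homogeneous f \<longleftrightarrow>
     (\<exists>d. \<forall>a\<in>Poly_Mapping.keys f. (\<Sum>i\<in>UNIV. Poly_Mapping.lookup a i) = d)"

text \<open>The zero polynomial (the case \<open>a = b\<close>) counts as a binomial.\<close>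

definition is_binomial :: "('s, 'a::comm_ring_1) mvpoly \<Rightarrow> bool" where
  "is_binomial f \<longleftrightarrow> (\<exists>a b. f = mv_monom a - mv_monom b)"


section \<open>Projective toric sets\<close>

definition proj_rel :: "('a::field ^ 's::finite) rel" where
  "proj_rel = {(x, y). x \<noteq> 0 \<and> y \<noteq> 0 \<and> (\<exists>c. c \<noteq> 0 \<and> y = c *s x)}"

definition proj_space :: "('a::field ^ 's::finite) set set" where
  "proj_space = (UNIV - {0}) // proj_rel"

definition proj_point :: "'a::field ^ 's::finite \<Rightarrow> ('a ^ 's) set" where
  "proj_point x = proj_rel `` {x}"

definition toric_set :: "('s::finite \<Rightarrow> nat ^ 'n::finite) \<Rightarrow> ('a::field ^ 's) set set" where
  "toric_set v =
     {proj_point (\<chi> i. \<Prod>j\<in>UNIV. (x $ j) ^ (v i $ j)) | x :: 'a ^ 'n. \<forall>j. x $ j \<noteq> 0}"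

text \<open>
  Whether a homogeneous polynomial vanishes at a representative of a projective point does not
  depend on the representative, so quantifying over all of them is harmless.
\<close>

definition vanishing_ideal :: "('a::field ^ 's::finite) set set \<Rightarrow> ('s, 'a) mvpoly set" where
  "vanishing_ideal Y =
     Idl\<^bsub>mvpoly_ring\<^esub> {f. mv_homogeneous f \<and> (\<forall>P\<in>Y. \<forall>x\<in>P. mv_eval f x = 0)}"

definition binomial_set_theoretic_ci :: "('s, 'a::comm_ring_1) mvpoly set \<Rightarrow> bool" where
  "binomial_set_theoretic_ci I \<longleftrightarrow>
     (\<exists>(r::nat) (g :: nat \<Rightarrow> ('s, 'a) mvpoly).
        ideal_height mvpoly_ring I = enat r \<and>
        (\<forall>i<r. is_binomial (g i)) \<and>
        rad_ideal mvpoly_ring I = rad_ideal mvpoly_ring (Idl\<^bsub>mvpoly_ring\<^esub> (g ` {..<r})))"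

lemma equiv_proj_rel: "equiv (UNIV - {0}) (proj_rel :: ('a::field ^ 's::finite) rel)"
proof (rule equivI)
  show "proj_rel \<subseteq> (UNIV - {0}) \<times> (UNIV - {0 :: 'a ^ 's})"
    unfolding proj_rel_def by blast
  show "refl_on (UNIV - {0}) (proj_rel :: ('a ^ 's) rel)"
  proof (rule refl_onI)
    fix x :: "'a ^ 's" assume "x \<in> UNIV - {0}"
    moreover have "(1::'a) \<noteq> 0" "x = 1 *s x" by simp_all
    ultimately show "(x, x) \<in> proj_rel" unfolding proj_rel_def by blast
  qed
  show "sym (proj_rel :: ('a ^ 's) rel)"
  proof (rule symI)
    fix x y :: "'a ^ 's" assume "(x, y) \<in> proj_rel"
    then obtain c where c: "x \<noteq> 0" "y \<noteq> 0" "c \<noteq> 0" "y = c *s x"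
      unfolding proj_rel_def by blast
    have "x = inverse c *s y" "inverse c \<noteq> 0"
      using c(3) unfolding c(4) by (simp_all add: vector_smult_assoc)
    with c(1,2) show "(y, x) \<in> proj_rel" unfolding proj_rel_def by blast
  qed
  show "trans (proj_rel :: ('a ^ 's) rel)"
  proof (rule transI)
    fix x y z :: "'a ^ 's" assume "(x, y) \<in> proj_rel" "(y, z) \<in> proj_rel"
    then obtain c d where cd: "x \<noteq> 0" "z \<noteq> 0" "c \<noteq> 0" "d \<noteq> 0" "y = c *s x" "z = d *s y"
      unfolding proj_rel_def by blast
    have "z = (d * c) *s x" "d * c \<noteq> 0"
      using cd(3,4) unfolding cd(5,6) by (simp_all add: vector_smult_assoc)
    with cd(1,2) show "(x, z) \<in> proj_rel" unfolding proj_rel_def by blast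
  qed
qed

lemma toric_set_subset:
  fixes v :: "'s::finite \<Rightarrow> nat ^ 'n::finite"
  shows "toric_set v \<subseteq> (proj_space :: ('a::field ^ 's) set set)"
proof
  fix P :: "('a ^ 's) set" assume "P \<in> toric_set v"
  then obtain x :: "'a ^ 'n" where x: "\<forall>j. x $ j \<noteq> 0"
    and P: "P = proj_point (\<chi> i. \<Prod>j\<in>UNIV. (x $ j) ^ (v i $ j))"
    unfolding toric_set_def by blast
  have "(\<chi> i. \<Prod>j\<in>UNIV. (x $ j) ^ (v i $ j)) \<noteq> (0 :: 'a ^ 's)"
    using x by (simp add: vec_eq_iff)
  then show "P \<in> proj_space"
    unfolding P proj_space_def proj_point_def by (intro quotientI) simp
qed

lemma mv_eval_scale:
  assumes "\<forall>a\<in>Poly_Mapping.keys f. (\<Sum>i\<in>UNIV. Poly_Mapping.lookup a i) = d"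
  shows "mv_eval f (c *s x) = c ^ d * mv_eval f x"
proof -
  have "(\<Prod>i\<in>UNIV. ((c *s x) $ i) ^ Poly_Mapping.lookup a i) =
          c ^ d * (\<Prod>i\<in>UNIV. (x $ i) ^ Poly_Mapping.lookup a i)"
    if "a \<in> Poly_Mapping.keys f" for a
  proof -
    have "(\<Prod>i\<in>UNIV. c ^ Poly_Mapping.lookup a i) = c ^ (\<Sum>i\<in>UNIV. Poly_Mapping.lookup a i)"
      by (simp only: power_sum)
    then show ?thesis
      using assms that by (simp add: power_mult_distrib prod.distrib)
  qed
  then show ?thesis
    unfolding mv_eval_def sum_distrib_left by (intro sum.cong refl) (simp add: mult_ac)
qed

end

theory Submission
  imports Defs "HOL-Number_Theory.Residues"
begin


text \<open>
  Write \<open>q\<close> for the size of the field, \<open>p\<close> for its characteristic, \<open>s\<close> for the number of variables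
  and \<open>Y\<close> for the group of points \<open>y\<close> with entries in the nonzero field elements that parameterizes
  the toric set. The two halves of the claim are the height, \<open>s - 1\<close>, and \<open>s - 1\<close> binomials.

  Binomials. Order the variables as \<open>t\<^sub>0, t\<^sub>1, \<dots>\<close>. Call two monomials equivalent if they have the same
  degree and agree on \<open>Y\<close>. For each \<open>j > 0\<close>, the differences in the exponent of \<open>t\<^sub>j\<close> between
  equivalent monomials in \<open>t\<^sub>0, \<dots>, t\<^sub>j\<close> are the multiples of some \<open>d > 0\<close>. If \<open>P\<close> is a large power of
  \<open>p\<close> with \<open>P \<equiv> 1\<close> modulo \<open>q - 1\<close>, then \<open>t\<^sub>j\<close> to the power \<open>d P\<close> is equivalent to a monomial \<open>t\<^sup>b\<close> in
  the earlier variables alone: negative exponents can be shifted by multiples of \<open>q - 1\<close>, and the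
  degree is then large enough. The differences of these pairs are the binomials, and \<open>J\<close> denotes the
  radical of the ideal they generate (\<open>exists_reducing_binomial\<close>).

  Modulo \<open>J\<close>, the binomial for \<open>t\<^sub>j\<close> removes \<open>t\<^sub>j\<close> from the \<open>P\<close>-th power of the difference of two
  equivalent monomials. This loses nothing, because in characteristic \<open>p\<close> the \<open>P\<close>-th power of a
  difference is the difference of the \<open>P\<close>-th powers, and \<open>J\<close> is radical. By induction on \<open>j\<close>, a power
  of \<open>t\<^sub>0\<close> times \<open>t\<^sup>f - t\<^sup>g\<close> lies in \<open>J\<close> whenever the two monomials are equivalent
  (\<open>extend_same_on\<close>). Distinct multiplicative functions on \<open>Y\<close> are linearly independent, so in a
  homogeneous polynomial \<open>f\<close> that vanishes on \<open>Y\<close> the coefficients over each equivalence class add up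
  to zero, and a power of \<open>t\<^sub>0\<close> times \<open>f\<close> lies in \<open>J\<close> (\<open>homogeneous_vanishing_saturated\<close>). Finally the
  power of \<open>t\<^sub>0\<close> can be dropped: modulo \<open>J\<close>, a power of each \<open>t\<^sub>j\<close> is a nonconstant monomial in the
  earlier variables, so that where \<open>t\<^sub>0\<close> vanishes all variables do
  (\<open>saturated_mem_radical\<close>).

  Height. A prime above the vanishing ideal contains the ideal of one of the finitely many points,
  because the product over all points of linear forms, each vanishing at its point, vanishes on the
  whole set (\<open>prime_over_vanishing_ideal\<close>). The ideal of a point is generated by \<open>s - 1\<close> linear forms,
  and these generate a chain of primes one after the other. Conversely, a chain of primes
  in the polynomial ring has length at most \<open>s\<close> (\<open>prime_chain_length_le\<close>), and any chain that ends in
  the ideal of a point can be prolonged by the ideal of the polynomials without constant term, so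
  that this ideal has height at most \<open>s - 1\<close>.
\<close>

section \<open>Ideals of a commutative ring type\<close>

lemma nat_pow_type_algebra:
  "x [^]\<^bsub>ring_of_type_algebra\<^esub> (n::nat) = (x::'r::comm_ring_1) ^ n"
proof -
  interpret cring "ring_of_type_algebra :: 'r ring" by (rule cring_from_type_algebra)
  show ?thesis
    by (induction n) (simp_all add: ring_of_type_algebra_def mult.commute)
qed

lemma ideal_type_algebra_iff:
  fixes I :: "'r::comm_ring_1 set"
  shows "ideal I ring_of_type_algebra \<longleftrightarrow>
    0 \<in> I \<and> (\<forall>x\<in>I. \<forall>y\<in>I. x + y \<in> I) \<and> (\<forall>r. \<forall>x\<in>I. r * x \<in> I)"
proof
  assume "ideal I ring_of_type_algebra"
  then interpret ideal I "ring_of_type_algebra :: 'r ring" .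
  show "0 \<in> I \<and> (\<forall>x\<in>I. \<forall>y\<in>I. x + y \<in> I) \<and> (\<forall>r. \<forall>x\<in>I. r * x \<in> I)"
    using additive_subgroup.zero_closed[OF additive_subgroup_axioms]
      additive_subgroup.a_closed[OF additive_subgroup_axioms] I_l_closed
    by (auto simp: ring_of_type_algebra_def)
next
  assume I: "0 \<in> I \<and> (\<forall>x\<in>I. \<forall>y\<in>I. x + y \<in> I) \<and> (\<forall>r. \<forall>x\<in>I. r * x \<in> I)"
  interpret cring "ring_of_type_algebra :: 'r ring" by (rule cring_from_type_algebra)
  have neg: "- x \<in> I" if "x \<in> I" for x
    using I that by (metis mult_minus1)
  have inv: "inv\<^bsub>add_monoid (ring_of_type_algebra :: 'r ring)\<^esub> x = - x" for x
    using minus_equality[of "- x" x] unfolding a_inv_def by (simp add: ring_of_type_algebra_def)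
  show "ideal I ring_of_type_algebra"
  proof (rule idealI)
    show "ring (ring_of_type_algebra :: 'r ring)" by (rule ring_axioms)
    show "subgroup I (add_monoid ring_of_type_algebra)"
      by (rule subgroup.intro)
        (use I neg inv in \<open>auto simp: ring_of_type_algebra_def\<close>)
    show "a \<otimes>\<^bsub>ring_of_type_algebra\<^esub> x \<in> I" if "a \<in> I" for a x
      using I that by (simp add: ring_of_type_algebra_def mult.commute[of a x])
  qed (use I in \<open>auto simp: ring_of_type_algebra_def\<close>)
qed

lemma
  fixes I :: "'r::comm_ring_1 set"
  assumes "ideal I ring_of_type_algebra"
  shows ideal_zero: "0 \<in> I"
    and ideal_add: "x \<in> I \<Longrightarrow> y \<in> I \<Longrightarrow> x + y \<in> I"
    and ideal_mult: "x \<in> I \<Longrightarrow> r * x \<in> I"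
    and ideal_mult_right: "x \<in> I \<Longrightarrow> x * r \<in> I"
    and ideal_uminus: "x \<in> I \<Longrightarrow> - x \<in> I"
    and ideal_diff: "x \<in> I \<Longrightarrow> y \<in> I \<Longrightarrow> x - y \<in> I"
    and ideal_sum: "(\<And>i. i \<in> A \<Longrightarrow> f i \<in> I) \<Longrightarrow> sum f A \<in> I"
proof -
  have I: "0 \<in> I" "\<And>x y. x \<in> I \<Longrightarrow> y \<in> I \<Longrightarrow> x + y \<in> I" "\<And>r x. x \<in> I \<Longrightarrow> r * x \<in> I"
    using assms unfolding ideal_type_algebra_iff by auto
  show "0 \<in> I" "x \<in> I \<Longrightarrow> y \<in> I \<Longrightarrow> x + y \<in> I" "x \<in> I \<Longrightarrow> r * x \<in> I" by (fact I)+
  show "x \<in> I \<Longrightarrow> x * r \<in> I" using I(3)[of x r] by (simp add: mult.commute)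
  show neg: "x \<in> I \<Longrightarrow> - x \<in> I" for x using I(3)[of x "- 1"] by simp
  show "x \<in> I \<Longrightarrow> y \<in> I \<Longrightarrow> x - y \<in> I" using I(2)[of x "- y"] neg[of y] by simp
  show "(\<And>i. i \<in> A \<Longrightarrow> f i \<in> I) \<Longrightarrow> sum f A \<in> I"
    by (induction A rule: infinite_finite_induct) (auto intro: I)
qed

lemma primeideal_type_algebra_iff:
  fixes P :: "'r::comm_ring_1 set"
  shows "primeideal P ring_of_type_algebra \<longleftrightarrow>
    ideal P ring_of_type_algebra \<and> 1 \<notin> P \<and> (\<forall>a b. a * b \<in> P \<longrightarrow> a \<in> P \<or> b \<in> P)"
proof
  assume "primeideal P ring_of_type_algebra"
  then interpret primeideal P "ring_of_type_algebra :: 'r ring" .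
  show "ideal P ring_of_type_algebra \<and> 1 \<notin> P \<and> (\<forall>a b. a * b \<in> P \<longrightarrow> a \<in> P \<or> b \<in> P)"
    using is_ideal I_notcarr I_prime one_imp_carrier
    by (auto simp: ring_of_type_algebra_def)
next
  assume P: "ideal P ring_of_type_algebra \<and> 1 \<notin> P \<and> (\<forall>a b. a * b \<in> P \<longrightarrow> a \<in> P \<or> b \<in> P)"
  show "primeideal P ring_of_type_algebra"
    by (rule primeidealI)
      (use P in \<open>auto simp: ring_of_type_algebra_def cring_from_type_algebra[unfolded ring_of_type_algebra_def]\<close>)
qed

lemma prime_prod_mem:
  fixes P :: "'r::comm_ring_1 set"
  assumes "primeideal P ring_of_type_algebra" "finite A" "prod f A \<in> P"
  obtains i where "i \<in> A" "f i \<in> P"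
proof -
  have "\<exists>i\<in>A. f i \<in> P"
    using assms(2,3) assms(1)[unfolded primeideal_type_algebra_iff]
    by (induction A rule: finite_induct) auto
  then show ?thesis using that by blast
qed

lemma prime_power_mem:
  fixes P :: "'r::comm_ring_1 set"
  assumes "primeideal P ring_of_type_algebra" "x ^ n \<in> P"
  shows "x \<in> P"
  using assms(2) assms(1)[unfolded primeideal_type_algebra_iff]
  by (induction n) auto

lemma
  fixes S :: "'r::comm_ring_1 set"
  shows genideal_type_ideal: "ideal (Idl\<^bsub>ring_of_type_algebra\<^esub> S) ring_of_type_algebra"
    and genideal_type_self: "S \<subseteq> Idl\<^bsub>ring_of_type_algebra\<^esub> S"
    and genideal_type_minimal:
      "ideal I ring_of_type_algebra \<Longrightarrow> S \<subseteq> I \<Longrightarrow> Idl\<^bsub>ring_of_type_algebra\<^esub> S \<subseteq> I"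
proof -
  interpret cring "ring_of_type_algebra :: 'r ring" by (rule cring_from_type_algebra)
  have S: "S \<subseteq> carrier ring_of_type_algebra" by (simp add: ring_of_type_algebra_def)
  show "ideal (Idl\<^bsub>ring_of_type_algebra\<^esub> S) ring_of_type_algebra" by (rule genideal_ideal[OF S])
  show "S \<subseteq> Idl\<^bsub>ring_of_type_algebra\<^esub> S" by (rule genideal_self[OF S])
  show "ideal I ring_of_type_algebra \<Longrightarrow> S \<subseteq> I \<Longrightarrow> Idl\<^bsub>ring_of_type_algebra\<^esub> S \<subseteq> I"
    by (rule genideal_minimal)
qed

lemma mem_rad_ideal_iff:
  "x \<in> rad_ideal ring_of_type_algebra I \<longleftrightarrow> (\<exists>k>0. (x::'r::comm_ring_1) ^ k \<in> I)"
  by (simp add: rad_ideal_def nat_pow_type_algebra) (simp add: ring_of_type_algebra_def)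

lemma rad_ideal_mono: "I \<subseteq> J \<Longrightarrow> rad_ideal R I \<subseteq> rad_ideal R J"
  unfolding rad_ideal_def by blast

lemma subset_rad_ideal: "(I :: 'r::comm_ring_1 set) \<subseteq> rad_ideal ring_of_type_algebra I"
  unfolding mem_rad_ideal_iff subset_iff by (metis power_one_right zero_less_one)

lemma rad_idealD:
  fixes x :: "'r::comm_ring_1"
  assumes "x ^ k \<in> rad_ideal ring_of_type_algebra I" "k > 0"
  shows "x \<in> rad_ideal ring_of_type_algebra I"
  using assms unfolding mem_rad_ideal_iff by (metis nat_0_less_mult_iff power_mult)

text \<open>Every term of \<open>(x + y)\<^sup>m\<^sup>+\<^sup>n\<close> contains \<open>x\<^sup>m\<close> or \<open>y\<^sup>n\<close>.\<close>

lemma ideal_rad_ideal: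
  fixes I :: "'r::comm_ring_1 set"
  assumes I: "ideal I ring_of_type_algebra"
  shows "ideal (rad_ideal ring_of_type_algebra I) ring_of_type_algebra"
  unfolding ideal_type_algebra_iff
proof (intro conjI ballI allI)
  show "0 \<in> rad_ideal ring_of_type_algebra I"
    using subset_rad_ideal ideal_zero[OF I] by blast
  fix x assume x: "x \<in> rad_ideal ring_of_type_algebra I"
  then obtain m where m: "m > 0" "x ^ m \<in> I" unfolding mem_rad_ideal_iff by blast
  show "r * x \<in> rad_ideal ring_of_type_algebra I" for r
    using m ideal_mult[OF I m(2), of "r ^ m"] unfolding mem_rad_ideal_iff
    by (metis power_mult_distrib)
  fix y assume "y \<in> rad_ideal ring_of_type_algebra I"
  then obtain n where n: "n > 0" "y ^ n \<in> I" unfolding mem_rad_ideal_iff by blast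
  have "of_nat ((m + n) choose k) * x ^ k * y ^ (m + n - k) \<in> I" if "k \<le> m + n" for k
  proof (cases "k \<ge> m")
    case True
    then have "x ^ k = x ^ (k - m) * x ^ m" by (simp flip: power_add)
    then have "x ^ k \<in> I" using ideal_mult[OF I m(2)] by simp
    then show ?thesis using ideal_mult[OF I] ideal_mult_right[OF I] by blast
  next
    case False
    then have "y ^ (m + n - k) = y ^ (m - k) * y ^ n" by (simp flip: power_add)
    then have "y ^ (m + n - k) \<in> I" using ideal_mult[OF I n(2)] by simp
    then show ?thesis using ideal_mult[OF I] by blast
  qed
  then have "(x + y) ^ (m + n) \<in> I"
    unfolding binomial_ring by (intro ideal_sum[OF I]) auto
  then show "x + y \<in> rad_ideal ring_of_type_algebra I"
    using m(1) unfolding mem_rad_ideal_iff by (metis add_gr_0)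
qed


section \<open>Monomials and substitution\<close>

definition mv_const :: "'a \<Rightarrow> ('s, 'a::comm_ring_1) mvpoly" where
  "mv_const c = Poly_Mapping.single 0 c"

definition mv_var :: "'s \<Rightarrow> ('s, 'a::comm_ring_1) mvpoly" where
  "mv_var i = mv_monom (Poly_Mapping.single i 1)"

text \<open>
  With finitely many variables, exponent vectors can be given as plain functions. This makes
  their arithmetic pointwise, and \<open>tpow f\<close> is the monomial \<open>t\<^sup>f\<close>.
\<close>

definition exponent :: "('s::finite \<Rightarrow> nat) \<Rightarrow> 's \<Rightarrow>\<^sub>0 nat" where
  "exponent f = Abs_poly_mapping f"

definition tpow :: "('s::finite \<Rightarrow> nat) \<Rightarrow> ('s, 'a::comm_ring_1) mvpoly" where
  "tpow f = mv_monom (exponent f)"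

lemma lookup_exponent [simp]: "Poly_Mapping.lookup (exponent f) = f"
  unfolding exponent_def by (rule lookup_Abs_poly_mapping) simp

lemma exponent_lookup [simp]: "exponent (Poly_Mapping.lookup a) = a"
  by (rule poly_mapping_eqI) simp

lemma mv_monom_lookup: "mv_monom a = tpow (Poly_Mapping.lookup a)"
  by (simp add: tpow_def)

lemma mv_monom_add: "mv_monom (a + b) = mv_monom a * mv_monom b"
  by (simp add: mv_monom_def mult_single)

lemma tpow_add: "tpow (\<lambda>i. f i + g i) = tpow f * tpow g"
proof -
  have "exponent (\<lambda>i. f i + g i) = exponent f + exponent g"
    by (rule poly_mapping_eqI) (simp add: lookup_add)
  then show ?thesis by (simp add: tpow_def mv_monom_add)
qed

lemma tpow_0 [simp]: "tpow (\<lambda>_::'s::finite. 0) = 1"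
proof -
  have "exponent (\<lambda>_::'s. 0) = 0" by (rule poly_mapping_eqI) simp
  then show ?thesis by (simp only: tpow_def mv_monom_def single_one)
qed

lemma tpow_mult: "tpow (\<lambda>i. n * f i) = tpow f ^ n"
  by (induction n) (simp_all add: tpow_add)

lemma tpow_var: "tpow (\<lambda>j. if j = i then n else 0) = mv_var i ^ n"
proof -
  have 1: "tpow (\<lambda>j. if j = i then 1 else 0) = mv_var i"
    unfolding tpow_def mv_var_def
    by (rule arg_cong[of _ _ mv_monom], rule poly_mapping_eqI) (auto simp: lookup_single when_def)
  have "(\<lambda>j. if j = i then n else 0) = (\<lambda>j. n * (if j = i then 1 else 0))" by auto
  then show ?thesis by (simp only: tpow_mult 1)
qed

lemma mv_const_hom [simp]:
  "mv_const 0 = 0" "mv_const 1 = 1" "mv_const (a + b) = mv_const a + mv_const b"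
  "mv_const (a * b) = mv_const a * mv_const b" "mv_const (a - b) = mv_const a - mv_const b"
  by (simp_all add: mv_const_def single_add mult_single single_diff)

lemma mv_const_power: "mv_const (a ^ n) = mv_const a ^ n"
  by (induction n) simp_all

lemma mv_expansion: "f = (\<Sum>a\<in>Poly_Mapping.keys f. mv_const (Poly_Mapping.lookup f a) * mv_monom a)"
proof (rule poly_mapping_eqI)
  fix k
  have "(\<Sum>a\<in>Poly_Mapping.keys f. Poly_Mapping.lookup f a when a = k) = Poly_Mapping.lookup f k"
    by (cases "k \<in> Poly_Mapping.keys f")
      (auto simp: when_def sum.delta in_keys_iff)
  then show "Poly_Mapping.lookup f k = Poly_Mapping.lookup
      (\<Sum>a\<in>Poly_Mapping.keys f. mv_const (Poly_Mapping.lookup f a) * mv_monom a) k"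
    by (simp add: lookup_sum mv_const_def mv_monom_def mult_single lookup_single)
qed

definition coeff_hom :: "('a::comm_ring_1 \<Rightarrow> 'r::comm_ring_1) \<Rightarrow> bool" where
  "coeff_hom h \<longleftrightarrow> h 0 = 0 \<and> h 1 = 1 \<and> (\<forall>a b. h (a + b) = h a + h b) \<and> (\<forall>a b. h (a * b) = h a * h b)"

text \<open>
  A homomorphism out of the polynomial ring is given by a map on the coefficients and the images
  of the variables. The evaluation at a point, the restriction to a line through the origin and the
  renumbering of the variables are all of this kind.
\<close>

definition mv_subst ::
  "('a::comm_ring_1 \<Rightarrow> 'r::comm_ring_1) \<Rightarrow> ('s::finite \<Rightarrow> 'r) \<Rightarrow> ('s, 'a) mvpoly \<Rightarrow> 'r" where
  "mv_subst h y f = (\<Sum>a\<in>Poly_Mapping.keys f. h (Poly_Mapping.lookup f a) * (\<Prod>i\<in>UNIV. y i ^ Poly_Mapping.lookup a i))"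

lemma mv_eval_subst: "mv_eval f x = mv_subst (\<lambda>c. c) (\<lambda>i. x $ i) f"
  by (simp add: mv_eval_def mv_subst_def)

lemma coeff_hom_id: "coeff_hom (\<lambda>c. c)" by (simp add: coeff_hom_def)

lemma coeff_hom_const: "coeff_hom mv_const" by (simp add: coeff_hom_def)

context
  fixes h :: "'a::comm_ring_1 \<Rightarrow> 'r::comm_ring_1" and y :: "'s::finite \<Rightarrow> 'r"
  assumes h: "coeff_hom h"
begin

lemma mv_subst_superset:
  assumes "finite K" "Poly_Mapping.keys f \<subseteq> K"
  shows "mv_subst h y f = (\<Sum>a\<in>K. h (Poly_Mapping.lookup f a) * (\<Prod>i\<in>UNIV. y i ^ Poly_Mapping.lookup a i))"
  unfolding mv_subst_def
  by (rule sum.mono_neutral_left) (use assms h in \<open>auto simp: in_keys_iff coeff_hom_def\<close>)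

lemma mv_subst_add: "mv_subst h y (f + g) = mv_subst h y f + mv_subst h y g"
proof -
  let ?K = "Poly_Mapping.keys f \<union> Poly_Mapping.keys g"
  have "mv_subst h y (f + g) = (\<Sum>a\<in>?K. h (Poly_Mapping.lookup (f + g) a) * (\<Prod>i\<in>UNIV. y i ^ Poly_Mapping.lookup a i))"
    by (rule mv_subst_superset) (use Poly_Mapping.keys_add[of f g] in auto)
  then show ?thesis
    using h mv_subst_superset[of ?K f] mv_subst_superset[of ?K g]
    by (simp add: lookup_add coeff_hom_def distrib_right sum.distrib)
qed

lemma mv_subst_0 [simp]: "mv_subst h y 0 = 0"
  by (simp add: mv_subst_def)

lemma mv_subst_sum: "mv_subst h y (sum f A) = (\<Sum>i\<in>A. mv_subst h y (f i))"
  by (induction A rule: infinite_finite_induct) (simp_all add: mv_subst_add)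

lemma mv_subst_single: 
  "mv_subst h y (Poly_Mapping.single a c) = h c * (\<Prod>i\<in>UNIV. y i ^ Poly_Mapping.lookup a i)"
  using mv_subst_superset[of "{a}" "Poly_Mapping.single a c"] by simp

lemma mv_subst_mult: "mv_subst h y (f * g) = mv_subst h y f * mv_subst h y g"
proof -
  let ?S = "\<lambda>f a. Poly_Mapping.single a (Poly_Mapping.lookup f a)"
  have exp: "f = (\<Sum>a\<in>Poly_Mapping.keys f. ?S f a)" for f :: "('s, 'a) mvpoly"
    using mv_expansion[of f] by (simp add: mv_const_def mv_monom_def mult_single)
  have "mv_subst h y (?S f a * ?S g b) = mv_subst h y (?S f a) * mv_subst h y (?S g b)" for a b
    using h by (simp add: mult_single mv_subst_single coeff_hom_def lookup_add power_add prod.distrib mult_ac)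
  then have "mv_subst h y ((\<Sum>a\<in>Poly_Mapping.keys f. ?S f a) * (\<Sum>b\<in>Poly_Mapping.keys g. ?S g b)) =
    mv_subst h y (\<Sum>a\<in>Poly_Mapping.keys f. ?S f a) * mv_subst h y (\<Sum>b\<in>Poly_Mapping.keys g. ?S g b)"
    by (simp only: sum_product mv_subst_sum)
  then show ?thesis by (simp only: exp[symmetric])
qed

lemma mv_subst_const: "mv_subst h y (mv_const c) = h c"
  by (simp add: mv_const_def mv_subst_single)

lemma mv_subst_1 [simp]: "mv_subst h y 1 = 1"
  using mv_subst_const[of 1] h by (simp add: coeff_hom_def)

lemma mv_subst_uminus: "mv_subst h y (- f) = - mv_subst h y f"
  using mv_subst_add[of f "- f"] by (simp add: eq_neg_iff_add_eq_0 add.commute)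

lemma mv_subst_diff: "mv_subst h y (f - g) = mv_subst h y f - mv_subst h y g"
  using mv_subst_add[of f "- g"] by (simp add: mv_subst_uminus)

lemma mv_subst_power: "mv_subst h y (f ^ n) = mv_subst h y f ^ n"
  by (induction n) (simp_all add: mv_subst_mult)

lemma mv_subst_prod: "mv_subst h y (prod f A) = (\<Prod>i\<in>A. mv_subst h y (f i))"
  by (induction A rule: infinite_finite_induct) (simp_all add: mv_subst_mult)

lemma mv_subst_tpow: "mv_subst h y (tpow f) = (\<Prod>i\<in>UNIV. y i ^ f i)"
  using h by (simp add: tpow_def mv_monom_def mv_subst_single coeff_hom_def)

lemma mv_subst_var: "mv_subst h y (mv_var i) = y i"
proof -
  have "y j ^ (1 when i = j) = (if j = i then y j else 1)" for j by (simp add: when_def)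
  then have "(\<Prod>j\<in>UNIV. y j ^ Poly_Mapping.lookup (Poly_Mapping.single i 1) j) = y i"
    by (simp only: lookup_single) (simp add: prod.delta)
  then show ?thesis
    using h by (simp only: mv_var_def mv_monom_def mv_subst_single) (simp add: coeff_hom_def)
qed

end

lemma tpow_eq_prod: "tpow f = (\<Prod>i\<in>UNIV. mv_var i ^ f i)"
proof -
  have monom_sum: "mv_monom (sum g A) = (\<Prod>i\<in>A. mv_monom (g i))" for A :: "'s::finite set" and g
    by (induction A rule: infinite_finite_induct)
      (simp_all add: mv_monom_add, simp_all add: mv_monom_def)
  have "exponent f = (\<Sum>i\<in>UNIV. exponent (\<lambda>j. if j = i then f i else 0))"
    by (rule poly_mapping_eqI) (simp add: lookup_sum)
  then have "tpow f = (\<Prod>i\<in>UNIV. tpow (\<lambda>j. if j = i then f i else 0))"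
    by (simp add: tpow_def monom_sum)
  then show ?thesis by (simp only: tpow_var)
qed

lemma mv_subst_comp:
  assumes h: "coeff_hom h"
  shows "mv_subst h z (mv_subst mv_const y f) = mv_subst h (\<lambda>i. mv_subst h z (y i)) f"
  unfolding mv_subst_def[of mv_const] mv_subst_sum[OF h] mv_subst_mult[OF h] mv_subst_prod[OF h]
    mv_subst_power[OF h] mv_subst_const[OF h]
  by (simp add: mv_subst_def)

lemma mv_subst_self: "mv_subst mv_const mv_var f = f"
  using mv_expansion[of f] by (simp add: mv_subst_def mv_monom_lookup tpow_eq_prod)


section \<open>Chains of primes in a polynomial ring over a finite field\<close>

text \<open>
  If a relation with unit coefficients between the \<open>x i\<close> held modulo the bottom prime, then its term
  with the lexicographically least exponent vector would force a unit into the top prime.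
  The induction splits off the least power of \<open>x 0\<close>: that power can be cancelled because \<open>x 0\<close> is
  outside the bottom prime, and modulo the next prime, which contains \<open>x 0\<close>, only the terms with
  exactly that power survive.
\<close>

lemma chain_independent:
  fixes P :: "nat \<Rightarrow> 'r::comm_ring_1 set"
  assumes "\<And>i. i \<le> n \<Longrightarrow> primeideal (P i) ring_of_type_algebra"
    and "\<And>i. i < n \<Longrightarrow> P i \<subseteq> P (Suc i)"
    and "\<And>i. i < n \<Longrightarrow> x i \<in> P (Suc i) - P i"
    and "finite A" "\<And>m. m \<in> A \<Longrightarrow> length m = n"
    and "\<And>m. m \<in> A \<Longrightarrow> c m dvd 1" "A \<noteq> {}"
  shows "(\<Sum>m\<in>A. c m * (\<Prod>i<n. x i ^ (m ! i))) \<notin> P 0"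
  using assms
proof (induction n arbitrary: P x A c)
  case 0
  then have "A = {[]}" by auto
  moreover obtain u where "1 = c [] * u" using 0(6)[of "[]"] \<open>A = {[]}\<close> by (auto elim: dvdE)
  moreover have "ideal (P 0) ring_of_type_algebra" "1 \<notin> P 0"
    using 0(1)[of 0] unfolding primeideal_type_algebra_iff by auto
  ultimately show ?case using ideal_mult_right[of "P 0" "c []" u] by auto
next
  case (Suc n)
  have P0: "ideal (P 0) ring_of_type_algebra" "\<And>a b. a * b \<in> P 0 \<Longrightarrow> a \<in> P 0 \<or> b \<in> P 0"
    and P1: "ideal (P 1) ring_of_type_algebra"
    using Suc.prems(1)[of 0] Suc.prems(1)[of 1] unfolding primeideal_type_algebra_iff by auto
  define e where "e = Min (hd ` A)"
  define A0 where "A0 = {m \<in> A. hd m = e}"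
  define T where "T m = (\<Prod>i<n. x (Suc i) ^ (tl m ! i))" for m :: "nat list"
  have e_le: "e \<le> hd m" if "m \<in> A" for m using that Suc.prems(4) by (simp add: e_def)
  have nonempty: "A0 \<noteq> {}"
  proof -
    have "e \<in> hd ` A" unfolding e_def using Suc.prems(4,7) by (intro Min_in) auto
    then show ?thesis by (auto simp: A0_def)
  qed
  have cons: "m = hd m # tl m" if "m \<in> A" for m
    using Suc.prems(5)[OF that] by (cases m) auto
  have inj: "inj_on tl A0"
    using cons by (intro inj_on_inverseI[of _ "(#) e"]) (auto simp: A0_def)
  have prod_split: "(\<Prod>i<Suc n. x i ^ (m ! i)) = x 0 ^ hd m * T m" if "m \<in> A" for m
    unfolding T_def prod.lessThan_Suc_shift
    by (cases m) (use Suc.prems(5)[OF that] in auto)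
  define low where "low = (\<Sum>m\<in>A0. c m * T m)"
  define high where "high = (\<Sum>m\<in>A - A0. c m * (x 0 ^ (hd m - Suc e) * T m))"
  have "(\<Sum>m\<in>A. c m * (x 0 ^ hd m * T m))
      = (\<Sum>m\<in>A0. c m * (x 0 ^ hd m * T m)) + (\<Sum>m\<in>A - A0. c m * (x 0 ^ hd m * T m))"
    using Suc.prems(4) by (subst sum.subset_diff[of A0 A]) (auto simp: A0_def add.commute)
  also have "(\<Sum>m\<in>A0. c m * (x 0 ^ hd m * T m)) = x 0 ^ e * low"
    unfolding low_def sum_distrib_left by (rule sum.cong) (auto simp: A0_def mult_ac)
  also have "(\<Sum>m\<in>A - A0. c m * (x 0 ^ hd m * T m)) = x 0 ^ e * (x 0 * high)"
    unfolding high_def sum_distrib_left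
  proof (rule sum.cong)
    fix m assume "m \<in> A - A0"
    then have "e < hd m" using e_le[of m] by (auto simp: A0_def)
    then have "x 0 ^ hd m = x 0 ^ e * (x 0 * x 0 ^ (hd m - Suc e))"
      by (metis Suc_leI add_Suc_right le_add_diff_inverse2 add.commute power_Suc power_add)
    then show "c m * (x 0 ^ hd m * T m) = x 0 ^ e * (x 0 * (c m * (x 0 ^ (hd m - Suc e) * T m)))"
      by (simp add: mult_ac)
  qed simp
  finally have sum_eq: "(\<Sum>m\<in>A. c m * (\<Prod>i<Suc n. x i ^ (m ! i))) = x 0 ^ e * (low + x 0 * high)"
    by (simp only: prod_split distrib_left cong: sum.cong)
  have "low = (\<Sum>m\<in>tl ` A0. c (e # m) * (\<Prod>i<n. x (Suc i) ^ (m ! i)))"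
    unfolding low_def T_def sum.reindex[OF inj]
    by (rule sum.cong) (use cons in \<open>auto simp: A0_def\<close>)
  also have "\<dots> \<notin> P (Suc 0)"
  proof (rule Suc.IH)
    show "c (e # m) dvd 1" if m: "m \<in> tl ` A0" for m
    proof -
      obtain m' where m': "m' \<in> A" "hd m' = e" "m = tl m'" using m by (auto simp: A0_def)
      show ?thesis using Suc.prems(6)[OF m'(1)] cons[OF m'(1)] m'(2,3) by simp
    qed
    show "length m = n" if "m \<in> tl ` A0" for m
      using that Suc.prems(5) unfolding A0_def by auto
  qed (use Suc.prems nonempty in \<open>auto simp: A0_def\<close>)
  finally have low: "low \<notin> P 1" by simp
  show ?case
  proof
    assume "(\<Sum>m\<in>A. c m * (\<Prod>i<Suc n. x i ^ (m ! i))) \<in> P 0"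
    then have "x 0 ^ e \<in> P 0 \<or> low + x 0 * high \<in> P 0" unfolding sum_eq by (rule P0(2))
    moreover have "x 0 ^ e \<notin> P 0"
      using prime_power_mem[of "P 0" "x 0"] Suc.prems(1)[of 0] Suc.prems(3)[of 0] by auto
    ultimately have "low + x 0 * high \<in> P 1" using Suc.prems(2)[of 0] by auto
    moreover have "x 0 * high \<in> P 1"
      using ideal_mult_right[OF P1] Suc.prems(3)[of 0] by auto
    ultimately have "low \<in> P 1" using ideal_diff[OF P1, of "low + x 0 * high" "x 0 * high"] by simp
    with low show False ..
  qed
qed

text \<open>
  The exponent of each variable is bounded separately, so that the admissible monomials form a box,
  which is easy to count.
\<close>

definition exponents_le :: "nat \<Rightarrow> ('s, 'a::comm_ring_1) mvpoly \<Rightarrow> bool" where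
  "exponents_le d f \<longleftrightarrow> (\<forall>a\<in>Poly_Mapping.keys f. \<forall>i. Poly_Mapping.lookup a i \<le> d)"

lemma exponents_le_mono: "exponents_le d f \<Longrightarrow> d \<le> d' \<Longrightarrow> exponents_le d' f"
  unfolding exponents_le_def by (meson order_trans)

lemma exponents_le_sum:
  "(\<And>i. i \<in> A \<Longrightarrow> exponents_le d (f i)) \<Longrightarrow> exponents_le d (sum f A)"
proof (induction A rule: infinite_finite_induct)
  case (insert i A)
  then show ?case using Poly_Mapping.keys_add[of "f i" "sum f A"] by (auto simp: exponents_le_def)
qed (auto simp: exponents_le_def)

lemma exponents_le_mult:
  assumes "exponents_le d f" "exponents_le d' g"
  shows "exponents_le (d + d') (f * g)"
  using assms keys_mult[of f g] unfolding exponents_le_def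
  by (fastforce simp: lookup_add intro: add_mono)

lemma exponents_le_const: "exponents_le 0 (mv_const c)"
  by (auto simp: exponents_le_def mv_const_def)

lemma exponents_le_power: "exponents_le d f \<Longrightarrow> exponents_le (n * d) (f ^ n)"
proof (induction n)
  case 0
  then show ?case using exponents_le_const[of 1] by simp
qed (auto intro: exponents_le_mult)

lemma exponents_le_prod:
  "(\<And>i. i \<in> A \<Longrightarrow> exponents_le d (f i)) \<Longrightarrow> exponents_le (card A * d) (prod f A)"
proof (induction A rule: infinite_finite_induct)
  case (insert i A)
  then show ?case using exponents_le_mult[of d "f i" "card A * d" "prod f A"] by simp
qed (use exponents_le_const[of 1] in simp_all)

lemma exponents_le_exists:
  fixes f :: "('s::finite, 'a::comm_ring_1) mvpoly"
  obtains d where "exponents_le d f"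
proof -
  let ?B = "(\<lambda>(a, i). Poly_Mapping.lookup a i) ` (Poly_Mapping.keys f \<times> UNIV)"
  have "finite ?B" by simp
  then have "\<forall>b\<in>?B. b \<le> Max ?B" by simp
  then have "exponents_le (Max ?B) f" unfolding exponents_le_def by fastforce
  then show ?thesis by (rule that)
qed

lemma card_exponents_le:
  fixes d :: nat
  defines "F \<equiv> {f :: ('s::finite, 'a::{comm_ring_1,finite}) mvpoly. exponents_le d f}"
  shows "finite F" "card F \<le> CARD('a) ^ (Suc d ^ CARD('s))"
proof -
  define E :: "('s \<Rightarrow> nat) set" where "E = PiE UNIV (\<lambda>_. {..d})"
  define r where "r f = restrict (\<lambda>e. Poly_Mapping.lookup f (exponent e)) E" for f :: "('s, 'a) mvpoly"
  have E: "finite E" "card E = Suc d ^ CARD('s)"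
    unfolding E_def by (simp_all add: finite_PiE card_PiE)
  have "inj_on r F"
  proof (intro inj_onI poly_mapping_eqI)
    fix f g a assume fg: "f \<in> F" "g \<in> F" and eq: "r f = r g"
    show "Poly_Mapping.lookup f a = Poly_Mapping.lookup g a"
    proof (cases "Poly_Mapping.lookup a \<in> E")
      case True
      then show ?thesis using fun_cong[OF eq, of "Poly_Mapping.lookup a"] by (simp add: r_def)
    next
      case False
      then have "a \<notin> Poly_Mapping.keys f" "a \<notin> Poly_Mapping.keys g"
        using fg by (auto simp: F_def exponents_le_def E_def PiE_iff)
      then show ?thesis by (simp add: in_keys_iff)
    qed
  qed
  moreover have "r ` F \<subseteq> PiE E (\<lambda>_. UNIV)" by (auto simp: r_def)
  moreover have "finite (PiE E (\<lambda>_. UNIV :: 'a set))" using E by (simp add: finite_PiE)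
  moreover have "card (PiE E (\<lambda>_. UNIV :: 'a set)) = CARD('a) ^ (Suc d ^ CARD('s))"
    using E by (simp add: card_PiE)
  ultimately show "finite F" "card F \<le> CARD('a) ^ (Suc d ^ CARD('s))"
    using inj_on_finite[of r F] card_inj_on_le[of r F "PiE E (\<lambda>_. UNIV)"] by auto
qed

text \<open>
  Over a finite field the pigeonhole principle shows that any \<open>s + 1\<close> polynomials in \<open>s\<close> variables are
  algebraically dependent. There are \<open>q\<close> to the power \<open>N\<^sup>s\<^sup>+\<^sup>1\<close> polynomial expressions of degree
  less than \<open>N\<close> in each of the \<open>s + 1\<close> elements. The exponents in their values grow linearly in \<open>N\<close>,
  so for some constant \<open>C\<close> there are at most \<open>q\<close> to the power \<open>(C N)\<^sup>s\<close> values. For large \<open>N\<close>, two expressions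
  have the same value.
\<close>

lemma algebraic_dependence:
  fixes x :: "nat \<Rightarrow> ('s::finite, 'a::{field,finite}) mvpoly"
  defines "n \<equiv> Suc CARD('s)"
  obtains A c where "finite A" "A \<noteq> {}" "\<And>m. m \<in> A \<Longrightarrow> length m = n" "\<And>m. m \<in> A \<Longrightarrow> c m \<noteq> 0"
    "(\<Sum>m\<in>A. mv_const (c m) * (\<Prod>i<n. x i ^ (m ! i))) = 0"
proof -
  have "\<exists>d. exponents_le d (x i)" for i using exponents_le_exists by blast
  then obtain dd where dd: "\<And>i. exponents_le (dd i) (x i)" by metis
  define d where "d = (\<Sum>i<n. dd i)"
  have d: "exponents_le d (x i)" if "i < n" for i
  proof (rule exponents_le_mono[OF dd])
    show "dd i \<le> d" unfolding d_def using that by (intro member_le_sum) auto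
  qed
  define C where "C = Suc (n * d)"
  \<comment> \<open>This choice makes \<open>(C N)\<^sup>s < N\<^sup>s\<^sup>+\<^sup>1\<close>.\<close>
  define N where "N = Suc (C ^ CARD('s))"
  define E where "E = {m :: nat list. set m \<subseteq> {..<N} \<and> length m = n}"
  have E: "finite E" "card E = N ^ n"
    unfolding E_def by (simp_all add: finite_lists_length_eq card_lists_length_eq)
  define V where "V k = (\<Sum>m\<in>E. mv_const (k m) * (\<Prod>i<n. x i ^ (m ! i)))" for k :: "nat list \<Rightarrow> 'a"
  define K where "K = PiE E (\<lambda>_. UNIV :: 'a set)"
  have V: "exponents_le (n * (N * d)) (V k)" for k
    unfolding V_def
  proof (rule exponents_le_sum)
    fix m assume m: "m \<in> E"
    have "exponents_le (N * d) (x i ^ (m ! i))" if "i < n" for i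
    proof (rule exponents_le_mono[OF exponents_le_power[OF d[OF that]]])
      have "m ! i \<in> {..<N}"
        using m that by (intro subsetD[OF _ nth_mem, of m]) (simp_all add: E_def)
      then show "m ! i * d \<le> N * d" by simp
    qed
    then have "exponents_le (card {..<n} * (N * d)) (\<Prod>i<n. x i ^ (m ! i))"
      by (intro exponents_le_prod) auto
    then show "exponents_le (n * (N * d)) (mv_const (k m) * (\<Prod>i<n. x i ^ (m ! i)))"
      using exponents_le_mult[OF exponents_le_const[of "k m"]] by simp
  qed
  have "N > 0" by (simp add: N_def)
  then have "Suc (n * (N * d)) \<le> N * C" by (simp add: C_def)
  then have "Suc (n * (N * d)) ^ CARD('s) \<le> (N * C) ^ CARD('s)" by (rule power_mono) simp
  also have "\<dots> < N ^ CARD('s) * N"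
    using \<open>N > 0\<close> unfolding power_mult_distrib
    by (intro mult_strict_left_mono) (simp_all only: N_def lessI zero_less_power)
  also have "\<dots> = card E" by (simp add: E n_def mult.commute)
  finally have less: "Suc (n * (N * d)) ^ CARD('s) < card E" .
  have "card (UNIV :: 'a set) > 1"
    using card_mono[of "UNIV :: 'a set" "{0, 1}"] by simp
  then have "CARD('a) ^ (Suc (n * (N * d)) ^ CARD('s)) < card K"
    using less E(1) by (simp add: K_def card_PiE del: power_Suc)
  moreover have "card (V ` K) \<le> CARD('a) ^ (Suc (n * (N * d)) ^ CARD('s))"
    using V by (intro order_trans[OF card_mono card_exponents_le(2)] card_exponents_le(1)) auto
  ultimately have "\<not> inj_on V K" by (intro pigeonhole) linarith
  then obtain k k' where k: "k \<in> K" "k' \<in> K" "k \<noteq> k'" "V k = V k'" unfolding inj_on_def by blast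
  define A where "A = {m \<in> E. k m \<noteq> k' m}"
  show ?thesis
  proof (rule that[of A "\<lambda>m. k m - k' m"])
    show "finite A" using E(1) by (auto simp: A_def)
    show "\<And>m. m \<in> A \<Longrightarrow> length m = n" "\<And>m. m \<in> A \<Longrightarrow> k m - k' m \<noteq> 0"
      by (auto simp: A_def E_def)
    show "A \<noteq> {}" using k PiE_ext[of k E "\<lambda>_. UNIV" k'] by (auto simp: A_def K_def)
    have "(\<Sum>m\<in>A. mv_const (k m - k' m) * (\<Prod>i<n. x i ^ (m ! i))) =
          (\<Sum>m\<in>E. mv_const (k m - k' m) * (\<Prod>i<n. x i ^ (m ! i)))"
      by (rule sum.mono_neutral_left) (use E in \<open>auto simp: A_def\<close>)
    also have "\<dots> = V k - V k'"
      by (simp add: V_def left_diff_distrib sum_subtractf)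
    finally show "(\<Sum>m\<in>A. mv_const (k m - k' m) * (\<Prod>i<n. x i ^ (m ! i))) = 0"
      using k by simp
  qed
qed

text \<open>
  This bounds the Krull dimension. An element picked from each step of a chain of length \<open>s + 1\<close>
  would give \<open>s + 1\<close> algebraically dependent polynomials, whose relation contradicts
  \<open>chain_independent\<close>.
\<close>

lemma prime_chain_length_le:
  fixes P :: "nat \<Rightarrow> ('s::finite, 'a::{field,finite}) mvpoly set"
  assumes "prime_chain mvpoly_ring k P"
  shows "k \<le> CARD('s)"
proof (rule ccontr)
  assume "\<not> k \<le> CARD('s)"
  define n where "n = Suc CARD('s)"
  have n: "n \<le> k" using \<open>\<not> k \<le> CARD('s)\<close> by (simp add: n_def)
  have prime: "primeideal (P i) ring_of_type_algebra" if "i \<le> n" for i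
    using assms that n by (simp add: prime_chain_def)
  have strict: "P i \<subset> P (Suc i)" if "i < n" for i
    using assms that n by (simp add: prime_chain_def)
  have "\<exists>y. i < n \<longrightarrow> y \<in> P (Suc i) - P i" for i using strict[of i] by blast
  then obtain x where x: "\<And>i. i < n \<Longrightarrow> x i \<in> P (Suc i) - P i" by metis
  obtain A c where A: "finite A" "A \<noteq> {}" "\<And>m. m \<in> A \<Longrightarrow> length m = n" "\<And>m. m \<in> A \<Longrightarrow> c m \<noteq> 0"
    "(\<Sum>m\<in>A. mv_const (c m) * (\<Prod>i<n. x i ^ (m ! i))) = 0"
    using algebraic_dependence[of x] unfolding n_def by blast
  have "mv_const (c m) dvd (1 :: ('s, 'a) mvpoly)" if "m \<in> A" for m
    using A(4)[OF that] by (intro dvdI[of _ _ "mv_const (inverse (c m))"]) (simp flip: mv_const_hom)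
  then have "(\<Sum>m\<in>A. mv_const (c m) * (\<Prod>i<n. x i ^ (m ! i))) \<notin> P 0"
    using A strict x prime by (intro chain_independent) auto
  moreover have "0 \<in> P 0"
    using prime[of 0] unfolding primeideal_type_algebra_iff by (blast intro: ideal_zero)
  ultimately show False using A(5) by simp
qed


section \<open>The ideals of points and their height\<close>

text \<open>
  Comparing leading monomials needs an ordering of the variables, which an arbitrary finite index
  type does not have. The ring is therefore embedded in the polynomials in variables numbered by \<open>nat\<close>,
  which form an integral domain.
\<close>

lemma mvpoly_no_zero_divisors:
  fixes f g :: "('s::finite, 'a::field) mvpoly"
  assumes "f * g = 0"
  shows "f = 0 \<or> g = 0"
proof -
  obtain idx :: "'s \<Rightarrow> nat" where idx: "inj idx"
    using finite_imp_inj_to_nat_seg[of "UNIV :: 's set"] by auto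
  define E :: "('s \<Rightarrow>\<^sub>0 nat) \<Rightarrow> (nat \<Rightarrow>\<^sub>0 nat)" where
    "E a = (\<Sum>i\<in>UNIV. Poly_Mapping.single (idx i) (Poly_Mapping.lookup a i))" for a
  define z :: "'s \<Rightarrow> ((nat \<Rightarrow>\<^sub>0 nat) \<Rightarrow>\<^sub>0 'a)" where
    "z i = Poly_Mapping.single (Poly_Mapping.single (idx i) 1) 1" for i
  define h :: "'a \<Rightarrow> ((nat \<Rightarrow>\<^sub>0 nat) \<Rightarrow>\<^sub>0 'a)" where "h = Poly_Mapping.single 0"
  have h: "coeff_hom h" by (simp add: h_def coeff_hom_def single_add mult_single)
  have "Poly_Mapping.lookup (E a) (idx i) = Poly_Mapping.lookup a i" for a i
    using idx by (simp add: E_def lookup_sum lookup_single when_def inj_eq sum.delta')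
  then have E: "inj E" by (metis injI poly_mapping_eqI)
  have single_power: "Poly_Mapping.single (Poly_Mapping.single k 1) (1::'a) ^ n
      = Poly_Mapping.single (Poly_Mapping.single k n) 1" for k n :: nat
    by (induction n) (simp_all add: mult_single flip: single_add)
  have single_prod: "(\<Prod>i\<in>B. Poly_Mapping.single (e i) (1::'a)) = Poly_Mapping.single (\<Sum>i\<in>B. e i) 1"
    for B and e :: "'s \<Rightarrow> (nat \<Rightarrow>\<^sub>0 nat)"
    by (induction B rule: infinite_finite_induct) (simp_all add: mult_single)
  have monom: "(\<Prod>i\<in>UNIV. z i ^ Poly_Mapping.lookup a i) = Poly_Mapping.single (E a) 1" for a
    unfolding z_def single_power single_prod E_def ..
  have inj: "f = 0" if "mv_subst h z f = 0" for f
  proof (rule poly_mapping_eqI)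
    fix b
    have "0 = Poly_Mapping.lookup (mv_subst h z f) (E b)" using that by simp
    also have "\<dots> = (\<Sum>a\<in>Poly_Mapping.keys f. Poly_Mapping.lookup f a when a = b)"
      unfolding mv_subst_def monom lookup_sum
      using E by (intro sum.cong) (simp_all add: h_def mult_single lookup_single inj_eq)
    also have "\<dots> = Poly_Mapping.lookup f b"
      by (cases "b \<in> Poly_Mapping.keys f") (auto simp: when_def sum.delta in_keys_iff)
    finally show "Poly_Mapping.lookup f b = Poly_Mapping.lookup 0 b" by simp
  qed
  have "mv_subst h z f * mv_subst h z g = 0"
    using assms mv_subst_mult[OF h, of z f g] by (simp add: mv_subst_0[OF h])
  then show ?thesis using inj by auto
qed

lemma prod_cong_mod_ideal:
  fixes I :: "'r::comm_ring_1 set"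
  assumes I: "ideal I ring_of_type_algebra"
    and "\<And>i. i \<in> A \<Longrightarrow> f i - g i \<in> I"
  shows "prod f A - prod g A \<in> I"
  using assms(2)
proof (induction A rule: infinite_finite_induct)
  case (insert i A)
  then have "f i * (prod f A - prod g A) + (f i - g i) * prod g A \<in> I"
    by (intro ideal_add[OF I] ideal_mult[OF I] ideal_mult_right[OF I]) auto
  then show ?case using insert.hyps by (simp add: algebra_simps)
qed (use ideal_zero[OF I] in auto)

lemma power_cong_mod_ideal:
  fixes I :: "'r::comm_ring_1 set"
  assumes "ideal I ring_of_type_algebra" "x - y \<in> I"
  shows "x ^ n - y ^ n \<in> I"
  using prod_cong_mod_ideal[of I "{..<n}" "\<lambda>_. x" "\<lambda>_. y"] assms by simp

lemma mv_subst_cong_mod_ideal: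
  fixes y z :: "'s::finite \<Rightarrow> 'r::comm_ring_1"
  assumes I: "ideal I ring_of_type_algebra" and "\<And>i. y i - z i \<in> I"
  shows "mv_subst h y f - mv_subst h z f \<in> I"
  unfolding mv_subst_def sum_subtractf[symmetric] right_diff_distrib[symmetric]
  using assms by (intro ideal_sum[OF I] ideal_mult[OF I] prod_cong_mod_ideal power_cong_mod_ideal)

text \<open>
  Suppose that the \<open>k\<close>-th coordinate of \<open>y\<close> is nonzero.
  For \<open>A = - {k}\<close> this substitution restricts polynomials to the line through the origin and \<open>y\<close>, and
  its kernel is the ideal of the projective point \<open>y\<close>. For smaller \<open>A\<close> only the coordinates in \<open>A\<close>
  are tied to the \<open>k\<close>-th one. The kernels for growing \<open>A\<close> form the chain of primes that bounds the
  height of that ideal from below.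
\<close>

definition line_subst :: "'s set \<Rightarrow> 's \<Rightarrow> 'a::field ^ 's::finite \<Rightarrow> 's \<Rightarrow> ('s, 'a) mvpoly" where
  "line_subst A k y i = (if i \<in> A then mv_const (y $ i / y $ k) * mv_var k else mv_var i)"

definition line_ideal :: "'s set \<Rightarrow> 's \<Rightarrow> 'a::field ^ 's::finite \<Rightarrow> ('s, 'a) mvpoly set" where
  "line_ideal A k y = {f. mv_subst mv_const (line_subst A k y) f = 0}"

text \<open>
  If the \<open>k\<close>-th coordinate of \<open>y\<close> is nonzero, these linear forms cut out the line through \<open>y\<close>, and
  the form for \<open>i = k\<close> is zero.
\<close>

definition point_form :: "'s \<Rightarrow> 'a::field ^ 's::finite \<Rightarrow> 's \<Rightarrow> ('s, 'a) mvpoly" where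
  "point_form k y i = mv_var i - mv_const (y $ i / y $ k) * mv_var k"

lemma prime_kernel:
  fixes y :: "'s::finite \<Rightarrow> 'r::comm_ring_1"
  assumes h: "coeff_hom h" and dom: "\<And>a b :: 'r. a * b = 0 \<Longrightarrow> a = 0 \<or> b = 0" and "(1::'r) \<noteq> 0"
  shows "primeideal {f. mv_subst h y f = 0} ring_of_type_algebra"
  unfolding primeideal_type_algebra_iff ideal_type_algebra_iff
  using assms(3) dom by (auto simp: mv_subst_0[OF h] mv_subst_1[OF h] mv_subst_add[OF h] mv_subst_mult[OF h])

lemma primeideal_line_ideal: "primeideal (line_ideal A k y) mvpoly_ring"
  unfolding line_ideal_def
  by (rule prime_kernel[OF coeff_hom_const mvpoly_no_zero_divisors]) auto

text \<open>
  Substituting for the variables in \<open>B\<close> after those in \<open>A \<subseteq> B\<close> is the same as substituting for those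
  in \<open>B\<close> at once.
\<close>

lemma line_ideal_mono:
  assumes "A \<subseteq> B" "k \<notin> B"
  shows "line_ideal A k y \<subseteq> line_ideal B k y"
proof
  fix f assume "f \<in> line_ideal A k y"
  then have "mv_subst mv_const (line_subst B k y) (mv_subst mv_const (line_subst A k y) f) = 0"
    by (simp add: line_ideal_def mv_subst_0[OF coeff_hom_const])
  moreover have "mv_subst mv_const (line_subst B k y) (line_subst A k y i) = line_subst B k y i" for i
    using assms by (auto simp: line_subst_def mv_subst_mult[OF coeff_hom_const]
        mv_subst_const[OF coeff_hom_const] mv_subst_var[OF coeff_hom_const])
  ultimately show "f \<in> line_ideal B k y"
    by (simp add: line_ideal_def mv_subst_comp[OF coeff_hom_const])
qed

lemma subst_point_form:
  "mv_subst mv_const (line_subst A k y) (point_form k y i)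
    = line_subst A k y i - mv_const (y $ i / y $ k) * line_subst A k y k"
  by (simp add: point_form_def mv_subst_diff[OF coeff_hom_const] mv_subst_mult[OF coeff_hom_const]
      mv_subst_const[OF coeff_hom_const] mv_subst_var[OF coeff_hom_const])

lemma mv_var_neq_0 [simp]: "(mv_var i :: ('s, 'a::comm_ring_1) mvpoly) \<noteq> 0"
proof
  assume "(mv_var i :: ('s, 'a) mvpoly) = 0"
  then have "Poly_Mapping.lookup (mv_var i :: ('s, 'a) mvpoly) (Poly_Mapping.single i 1) = 0" by simp
  then show False by (simp add: mv_var_def mv_monom_def)
qed

lemma point_form_neq_0:
  assumes "i \<noteq> k"
  shows "point_form k y i \<noteq> 0"
proof -
  have "Poly_Mapping.single k (1::nat) \<noteq> Poly_Mapping.single i 1"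
    using assms by (metis lookup_single_eq lookup_single_not_eq zero_neq_one)
  then have "Poly_Mapping.lookup (point_form k y i) (Poly_Mapping.single i 1) = 1"
    by (simp add: point_form_def mv_var_def mv_monom_def mv_const_def lookup_minus mult_single lookup_single_not_eq)
  then show ?thesis by auto
qed

lemma line_ideal_strict:
  assumes "A \<subseteq> B" "k \<notin> B" "i \<in> B - A"
  shows "line_ideal A k y \<subset> line_ideal B k y"
proof -
  have "k \<notin> A" "i \<noteq> k" using assms by auto
  then have "point_form k y i \<notin> line_ideal A k y"
    using point_form_neq_0[of i k y] assms unfolding line_ideal_def
    by (simp add: subst_point_form) (simp add: line_subst_def point_form_def)
  moreover have "point_form k y i \<in> line_ideal B k y"
    using assms unfolding line_ideal_def by (simp add: subst_point_form) (simp add: line_subst_def)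
  ultimately show ?thesis using line_ideal_mono[OF assms(1,2), of y] by blast
qed

text \<open>
  Modulo the linear forms, the substitution does not change a polynomial. Hence a
  polynomial that it sends to zero is congruent to zero.
\<close>

lemma line_ideal_subset:
  assumes I: "ideal I mvpoly_ring" and "\<And>i. i \<noteq> k \<Longrightarrow> point_form k y i \<in> I"
  shows "line_ideal (- {k}) k y \<subseteq> I"
proof
  fix f assume f: "f \<in> line_ideal (- {k}) k y"
  have "mv_var i - line_subst (- {k}) k y i \<in> I" for i
    using assms(2)[of i] ideal_zero[OF I] by (auto simp: line_subst_def point_form_def)
  then have "mv_subst mv_const mv_var f - mv_subst mv_const (line_subst (- {k}) k y) f \<in> I"
    by (rule mv_subst_cong_mod_ideal[OF I])
  then show "f \<in> I" using f by (simp add: mv_subst_self line_ideal_def)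
qed

definition const_free :: "('s::finite, 'a::comm_ring_1) mvpoly set" where
  "const_free = {f. mv_subst (\<lambda>c. c) (\<lambda>_. 0) f = 0}"

lemma primeideal_const_free: "primeideal (const_free :: ('s::finite, 'a::field) mvpoly set) mvpoly_ring"
  unfolding const_free_def by (rule prime_kernel[OF coeff_hom_id]) auto

lemma line_ideal_psubset_const_free: "line_ideal (- {k}) k y \<subset> const_free"
proof
  show "line_ideal (- {k}) k y \<subseteq> const_free"
  proof
    fix f assume "f \<in> line_ideal (- {k}) k y"
    then have "mv_subst (\<lambda>c. c) (\<lambda>_. 0) (mv_subst mv_const (line_subst (- {k}) k y) f) = 0"
      by (simp add: line_ideal_def mv_subst_0[OF coeff_hom_id])
    moreover have "mv_subst (\<lambda>c. c) (\<lambda>_. 0) (line_subst (- {k}) k y i) = 0" for i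
      by (simp add: line_subst_def mv_subst_mult[OF coeff_hom_id] mv_subst_var[OF coeff_hom_id])
    ultimately show "f \<in> const_free"
      by (simp add: const_free_def mv_subst_comp[OF coeff_hom_id])
  qed
  have "mv_var k \<in> const_free" "mv_var k \<notin> line_ideal (- {k}) k y"
    by (simp_all add: const_free_def line_ideal_def line_subst_def
        mv_subst_var[OF coeff_hom_id] mv_subst_var[OF coeff_hom_const])
  then show "line_ideal (- {k}) k y \<noteq> const_free" by blast
qed

text \<open>
  The variables other than \<open>t\<^sub>k\<close> are tied to \<open>t\<^sub>k\<close> one after the other. The last prime of the
  resulting chain may be smaller than \<open>p\<close>, so \<open>p\<close> takes its place.
\<close>

lemma prime_height_ge:
  fixes y :: "'a::field ^ 's::finite"
  assumes p: "primeideal p mvpoly_ring" and sub: "line_ideal (- {k}) k y \<subseteq> p"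
  shows "enat (CARD('s) - 1) \<le> prime_height mvpoly_ring p"
proof -
  define n where "n = CARD('s) - 1"
  have "card (- {k}) = n" by (simp add: n_def Compl_eq_Diff_UNIV)
  then obtain e where e: "bij_betw e {..<n} (- {k})"
    using ex_bij_betw_nat_finite[of "- {k}"] by (auto simp: lessThan_atLeast0)
  define Q where "Q i = line_ideal (e ` {..<i}) k y" for i
  have k: "k \<notin> e ` {..<i}" if "i \<le> n" for i
  proof -
    have "e ` {..<i} \<subseteq> e ` {..<n}" using that by auto
    then show ?thesis using e by (auto simp: bij_betw_def)
  qed
  have Q: "Q i \<subset> Q (Suc i)" if "i < n" for i
  proof -
    have "e i \<notin> e ` {..<i}"
    proof
      assume "e i \<in> e ` {..<i}"
      then obtain j where j: "j < i" "e i = e j" by auto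
      then have "i = j" using e that inj_onD[of e "{..<n}" i j] by (simp add: bij_betw_def)
      then show False using j(1) by simp
    qed
    then show ?thesis unfolding Q_def
      by (intro line_ideal_strict[where i = "e i"] k) (use that in auto)
  qed
  have "Q n \<subseteq> p" using sub e by (simp add: Q_def bij_betw_def)
  then have "(if i < n then Q i else p) \<subset> (if Suc i < n then Q (Suc i) else p)" if "i < n" for i
    using Q[OF that] that by (cases "Suc i = n") auto
  then have "prime_chain mvpoly_ring n (\<lambda>i. if i < n then Q i else p)"
    unfolding prime_chain_def by (simp add: Q_def primeideal_line_ideal p)
  then show ?thesis unfolding prime_height_def n_def[symmetric]
    by (intro Sup_upper) auto
qed

text \<open>
  A chain ending in the ideal of a point can be prolonged by the prime \<open>const_free\<close>, so its length
  stays below the maximal length \<open>s\<close> of a chain.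
\<close>

lemma prime_height_line_ideal:
  fixes y :: "'a::{field,finite} ^ 's::finite"
  shows "prime_height mvpoly_ring (line_ideal (- {k}) k y) \<le> enat (CARD('s) - 1)"
  unfolding prime_height_def
proof (rule Sup_least, safe)
  fix n and P :: "nat \<Rightarrow> ('s, 'a) mvpoly set"
  assume P: "prime_chain mvpoly_ring n P" "P n = line_ideal (- {k}) k y"
  have "prime_chain mvpoly_ring (Suc n) (\<lambda>i. if i \<le> n then P i else const_free)"
    using P primeideal_const_free line_ideal_psubset_const_free[of k y]
    unfolding prime_chain_def by (auto simp: le_Suc_eq less_Suc_eq)
  then have "Suc n \<le> CARD('s)" by (rule prime_chain_length_le)
  then show "enat n \<le> enat (CARD('s) - 1)" by simp
qed


section \<open>The vanishing ideal of a toric set\<close>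

definition homogeneous_deg :: "nat \<Rightarrow> ('s::finite, 'a::comm_ring_1) mvpoly \<Rightarrow> bool" where
  "homogeneous_deg d f \<longleftrightarrow> (\<forall>a\<in>Poly_Mapping.keys f. (\<Sum>i\<in>UNIV. Poly_Mapping.lookup a i) = d)"

lemma mv_homogeneous_iff: "mv_homogeneous f \<longleftrightarrow> (\<exists>d. homogeneous_deg d f)"
  by (simp add: mv_homogeneous_def homogeneous_deg_def)

lemma homogeneous_deg_diff:
  "homogeneous_deg d f \<Longrightarrow> homogeneous_deg d g \<Longrightarrow> homogeneous_deg d (f - g)"
  using keys_diff[of f g] unfolding homogeneous_deg_def by blast

lemma homogeneous_deg_mult:
  "homogeneous_deg d f \<Longrightarrow> homogeneous_deg d' g \<Longrightarrow> homogeneous_deg (d + d') (f * g)"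
  using keys_mult[of f g] unfolding homogeneous_deg_def
  by (fastforce simp: lookup_add sum.distrib)

lemma homogeneous_deg_const: "homogeneous_deg 0 (mv_const c)"
  by (auto simp: homogeneous_deg_def mv_const_def)

lemma homogeneous_deg_tpow: "homogeneous_deg (\<Sum>i\<in>UNIV. f i) (tpow f)"
  by (auto simp: homogeneous_deg_def tpow_def mv_monom_def)

lemma homogeneous_deg_var: "homogeneous_deg 1 (mv_var i)"
  using homogeneous_deg_tpow[of "\<lambda>j. if j = i then 1 else 0"] unfolding tpow_var by (simp add: sum.delta)

lemma mv_homogeneous_prod: "(\<And>i. i \<in> A \<Longrightarrow> mv_homogeneous (f i)) \<Longrightarrow> mv_homogeneous (prod f A)"
proof (induction A rule: infinite_finite_induct)
  case (insert i A)
  then show ?case unfolding mv_homogeneous_iff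
    by (metis homogeneous_deg_mult insertI1 insertI2 prod.insert)
qed (use homogeneous_deg_const[of 1] in \<open>auto simp: mv_homogeneous_iff\<close>)

lemma mv_homogeneous_point_form: "mv_homogeneous (point_form k y i)"
  unfolding point_form_def mv_homogeneous_iff
  using homogeneous_deg_diff[OF homogeneous_deg_var homogeneous_deg_mult[OF homogeneous_deg_const homogeneous_deg_var, unfolded add_0]]
  by blast

definition torus_points :: "('s::finite \<Rightarrow> nat ^ 'n::finite) \<Rightarrow> ('a::field ^ 's) set" where
  "torus_points v = {\<chi> i. \<Prod>j\<in>UNIV. (x $ j) ^ (v i $ j) | x :: 'a ^ 'n. \<forall>j. x $ j \<noteq> 0}"

lemma torus_points_nonzero: "y \<in> torus_points v \<Longrightarrow> y $ i \<noteq> 0"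
  unfolding torus_points_def by auto

lemma torus_points_1: "(\<chi> i. 1) \<in> torus_points v"
  unfolding torus_points_def by (auto intro!: exI[of _ "\<chi> i. 1"])

lemma torus_points_mult:
  fixes v :: "'s::finite \<Rightarrow> nat ^ 'n::finite" and y z :: "'a::field ^ 's"
  assumes "y \<in> torus_points v" "z \<in> torus_points v"
  shows "(\<chi> i. y $ i * z $ i) \<in> torus_points v"
proof -
  obtain x w :: "'a ^ 'n" where "\<forall>j. x $ j \<noteq> 0" "y = (\<chi> i. \<Prod>j\<in>UNIV. (x $ j) ^ (v i $ j))"
    and "\<forall>j. w $ j \<noteq> 0" "z = (\<chi> i. \<Prod>j\<in>UNIV. (w $ j) ^ (v i $ j))"
    using assms unfolding torus_points_def by blast
  then show ?thesis unfolding torus_points_def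
    by (intro CollectI exI[of _ "\<chi> j. x $ j * w $ j"]) (simp add: power_mult_distrib prod.distrib)
qed

lemma toric_set_eq: "toric_set v = proj_point ` torus_points v"
  unfolding toric_set_def torus_points_def by blast

lemma vanishes_on_toric_set_iff:
  fixes v :: "'s::finite \<Rightarrow> nat ^ 'n::finite" and f :: "('s, 'a::field) mvpoly"
  assumes "mv_homogeneous f"
  shows "(\<forall>P\<in>toric_set v. \<forall>x\<in>P. mv_eval f x = 0) \<longleftrightarrow> (\<forall>y\<in>torus_points v. mv_eval f y = 0)"
proof
  assume *: "\<forall>P\<in>toric_set v. \<forall>x\<in>P. mv_eval f x = 0"
  show "\<forall>y\<in>torus_points v. mv_eval f y = 0"
  proof
    fix y :: "'a ^ 's" assume y: "y \<in> torus_points v"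
    then have "y \<noteq> 0" using torus_points_nonzero by fastforce
    then have "y \<in> proj_point y"
      using equiv_class_self[OF equiv_proj_rel] unfolding proj_point_def by blast
    then show "mv_eval f y = 0" using * y unfolding toric_set_eq by blast
  qed
next
  assume *: "\<forall>y\<in>torus_points v. mv_eval f y = 0"
  obtain d where "\<forall>a\<in>Poly_Mapping.keys f. (\<Sum>i\<in>UNIV. Poly_Mapping.lookup a i) = d"
    using assms unfolding mv_homogeneous_def by blast
  then have "mv_eval f (c *s x) = c ^ d * mv_eval f x" for c x by (rule mv_eval_scale)
  then show "\<forall>P\<in>toric_set v. \<forall>x\<in>P. mv_eval f x = 0"
    using * unfolding toric_set_eq proj_point_def proj_rel_def by auto
qed

lemma vanishing_ideal_toric:
  "vanishing_ideal (toric_set v) =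
    Idl\<^bsub>mvpoly_ring\<^esub> {f. mv_homogeneous f \<and> (\<forall>y\<in>torus_points v. mv_eval f y = 0)}"
  unfolding vanishing_ideal_def
  by (rule arg_cong[of _ _ "genideal mvpoly_ring"]) (use vanishes_on_toric_set_iff in blast)

lemma mv_subst_const_point:
  fixes f :: "('s::finite, 'a::comm_ring_1) mvpoly"
  shows "mv_subst mv_const (\<lambda>i. mv_const (z $ i)) f = mv_const (mv_eval f z)"
proof -
  have const_sum: "mv_const (sum g A) = (\<Sum>a\<in>A. mv_const (g a))" for g :: "('s \<Rightarrow>\<^sub>0 nat) \<Rightarrow> 'a" and A
    by (induction A rule: infinite_finite_induct) simp_all
  have const_prod: "mv_const (prod g A) = (\<Prod>i\<in>A. mv_const (g i))" for g :: "'s \<Rightarrow> 'a" and A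
    by (induction A rule: infinite_finite_induct) simp_all
  show ?thesis by (simp add: mv_subst_def mv_eval_def const_sum const_prod mv_const_power)
qed

text \<open>
  On the line through \<open>y\<close>, a homogeneous polynomial is its value at a point of that line times a power
  of \<open>t\<^sub>k\<close>.
\<close>

lemma vanishing_ideal_subset_line_ideal:
  fixes v :: "'s::finite \<Rightarrow> nat ^ 'n::finite" and y :: "'a::field ^ 's"
  assumes y: "y \<in> torus_points v"
  shows "vanishing_ideal (toric_set v) \<subseteq> line_ideal (- {k}) k y"
  unfolding vanishing_ideal_toric
proof (rule genideal_type_minimal)
  show "ideal (line_ideal (- {k}) k y) mvpoly_ring"
    using primeideal_line_ideal primeideal.axioms(1) by blast
  show "{f. mv_homogeneous f \<and> (\<forall>y\<in>torus_points v. mv_eval f y = 0)} \<subseteq> line_ideal (- {k}) k y"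
  proof safe
    fix f :: "('s, 'a) mvpoly"
    assume f: "mv_homogeneous f" "\<forall>y\<in>torus_points v. mv_eval f y = 0"
    \<comment> \<open>the representative of the projective point \<open>y\<close> with \<open>k\<close>-th coordinate 1\<close>
    define z where "z = inverse (y $ k) *s y"
    obtain d where d: "\<forall>a\<in>Poly_Mapping.keys f. (\<Sum>i\<in>UNIV. Poly_Mapping.lookup a i) = d"
      using f(1) unfolding mv_homogeneous_def by blast
    have "line_subst (- {k}) k y i = mv_const (z $ i) * mv_var k" for i
      using torus_points_nonzero[OF y, of k]
      by (auto simp: line_subst_def z_def field_simps)
    then have "mv_subst mv_const (line_subst (- {k}) k y) f =
      (\<Sum>a\<in>Poly_Mapping.keys f. mv_const (Poly_Mapping.lookup f a) *
        (\<Prod>i\<in>UNIV. mv_const (z $ i) ^ Poly_Mapping.lookup a i) * mv_var k ^ (\<Sum>i\<in>UNIV. Poly_Mapping.lookup a i))"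
      by (simp add: mv_subst_def power_mult_distrib prod.distrib power_sum mult.assoc)
    also have "\<dots> = (\<Sum>a\<in>Poly_Mapping.keys f. mv_const (Poly_Mapping.lookup f a) *
        (\<Prod>i\<in>UNIV. mv_const (z $ i) ^ Poly_Mapping.lookup a i)) * mv_var k ^ d"
      using d by (simp add: sum_distrib_right)
    also have "\<dots> = mv_subst mv_const (\<lambda>i. mv_const (z $ i)) f * mv_var k ^ d"
      by (simp add: mv_subst_def)
    also have "mv_subst mv_const (\<lambda>i. mv_const (z $ i)) f = mv_const (mv_eval f z)"
      by (rule mv_subst_const_point)
    also have "mv_eval f z = 0"
      using f(2) y unfolding z_def mv_eval_scale[OF d] by simp
    finally show "f \<in> line_ideal (- {k}) k y" by (simp add: line_ideal_def)
  qed
qed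

text \<open>
  If a prime misses one of the linear forms of every point, then it misses their product over all
  points. But that product is homogeneous and vanishes on the toric set.
\<close>

lemma prime_over_vanishing_ideal:
  fixes v :: "'s::finite \<Rightarrow> nat ^ 'n::finite"
  assumes p: "primeideal p mvpoly_ring"
    and sub: "vanishing_ideal (toric_set v :: ('a::{field,finite} ^ 's) set set) \<subseteq> p"
  obtains y where "y \<in> torus_points v" "line_ideal (- {k}) k y \<subseteq> p"
proof -
  have "\<exists>y\<in>torus_points v. \<forall>i. point_form k y i \<in> p"
  proof (rule ccontr)
    assume "\<not> ?thesis"
    then obtain i where i: "\<And>y. y \<in> torus_points v \<Longrightarrow> point_form k y (i y) \<notin> p" by metis
    define f where "f = (\<Prod>y\<in>torus_points v. point_form k y (i y))"
    have "mv_homogeneous f"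
      unfolding f_def by (intro mv_homogeneous_prod mv_homogeneous_point_form)
    moreover have "mv_eval f y = 0" if y: "y \<in> torus_points v" for y
    proof -
      have "mv_eval (point_form k y (i y)) y = 0"
        using torus_points_nonzero[OF y, of k]
        by (simp add: mv_eval_subst point_form_def mv_subst_diff[OF coeff_hom_id] mv_subst_mult[OF coeff_hom_id]
            mv_subst_const[OF coeff_hom_id] mv_subst_var[OF coeff_hom_id])
      then show ?thesis
        using y by (auto simp: f_def mv_eval_subst mv_subst_prod[OF coeff_hom_id] intro!: prod_zero bexI[of _ y])
    qed
    ultimately have "f \<in> vanishing_ideal (toric_set v)"
      unfolding vanishing_ideal_toric by (intro subsetD[OF genideal_type_self]) simp
    then have "f \<in> p" using sub by (rule subsetD[rotated])
    then obtain y where "y \<in> torus_points v" "point_form k y (i y) \<in> p"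
      unfolding f_def using prime_prod_mem[OF p] by (metis finite)
    then show False using i by blast
  qed
  then show ?thesis
    using that line_ideal_subset p unfolding primeideal_type_algebra_iff by metis
qed

lemma ideal_height_vanishing_ideal:
  fixes v :: "'s::finite \<Rightarrow> nat ^ 'n::finite"
  shows "ideal_height mvpoly_ring (vanishing_ideal (toric_set v :: ('a::{field,finite} ^ 's) set set))
    = enat (CARD('s) - 1)"
proof (rule antisym)
  obtain k :: 's where True by simp
  show "enat (CARD('s) - 1) \<le> ideal_height mvpoly_ring (vanishing_ideal (toric_set v :: ('a ^ 's) set set))"
    unfolding ideal_height_def
  proof (rule Inf_greatest, safe)
    fix p assume "primeideal p mvpoly_ring" "vanishing_ideal (toric_set v :: ('a ^ 's) set set) \<subseteq> p"
    then show "enat (CARD('s) - 1) \<le> prime_height mvpoly_ring p"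
      using prime_over_vanishing_ideal[of p v k] prime_height_ge by metis
  qed
  let ?Q = "line_ideal (- {k}) k ((\<chi> i. 1) :: 'a ^ 's)"
  have "ideal_height mvpoly_ring (vanishing_ideal (toric_set v :: ('a ^ 's) set set)) \<le> prime_height mvpoly_ring ?Q"
    unfolding ideal_height_def
    using primeideal_line_ideal vanishing_ideal_subset_line_ideal[OF torus_points_1]
    by (intro Inf_lower) blast
  also have "\<dots> \<le> enat (CARD('s) - 1)" by (rule prime_height_line_ideal)
  finally show "ideal_height mvpoly_ring (vanishing_ideal (toric_set v :: ('a ^ 's) set set)) \<le> enat (CARD('s) - 1)" .
qed


section \<open>Monomial functions on the toric set\<close>

definition vpow :: "'a::comm_ring_1 ^ 's::finite \<Rightarrow> ('s \<Rightarrow> nat) \<Rightarrow> 'a" where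
  "vpow y f = (\<Prod>i\<in>UNIV. (y $ i) ^ f i)"

text \<open>
  The equivalence of monomials behind the proof: \<open>f\<close> and \<open>g\<close> are related iff the binomial \<open>t\<^sup>f - t\<^sup>g\<close> is
  homogeneous and vanishes on \<open>Y\<close>.
\<close>

definition same_on :: "('a::comm_ring_1 ^ 's::finite) set \<Rightarrow> ('s \<Rightarrow> nat) \<Rightarrow> ('s \<Rightarrow> nat) \<Rightarrow> bool" where
  "same_on Y f g \<longleftrightarrow> sum f UNIV = sum g UNIV \<and> (\<forall>y\<in>Y. vpow y f = vpow y g)"

lemma vpow_add: "vpow y (\<lambda>i. f i + g i) = vpow y f * vpow y g"
  by (simp add: vpow_def power_add prod.distrib)

lemma vpow_mult: "vpow y (\<lambda>i. n * f i) = vpow y f ^ n"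
  by (simp add: vpow_def prod_power_distrib mult.commute[of n] power_mult)

lemma vpow_single: "vpow y (\<lambda>i. if i = k then n else 0) = y $ k ^ n"
proof -
  have "(y $ i) ^ (if i = k then n else 0) = (if i = k then y $ k ^ n else 1)" for i by simp
  then show ?thesis by (simp add: vpow_def prod.delta)
qed

lemma vpow_nonzero: "(\<And>i. y $ i \<noteq> 0) \<Longrightarrow> vpow y f \<noteq> (0 :: 'a::field)"
  by (simp add: vpow_def)

lemma split_exponent:
  fixes f :: "'s \<Rightarrow> nat"
  shows "f = (\<lambda>i. (if i = j then f j else 0) + (f(j := 0)) i)"
  by auto

lemma mv_eval_tpow: "mv_eval (tpow f) y = vpow y f"
  by (simp add: mv_eval_subst mv_subst_tpow[OF coeff_hom_id] vpow_def)

text \<open>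
  Artin's independence of characters. Shifting a relation by an element \<open>y0\<close> at which \<open>u i\<close> and
  \<open>u j\<close> differ, and subtracting \<open>u i y0\<close> times the relation, eliminates \<open>u i\<close> but
  keeps \<open>u j\<close>.
\<close>

lemma multiplicative_independent:
  fixes u :: "'i \<Rightarrow> 'g \<Rightarrow> 'a::field"
  assumes "finite R"
    and mult: "\<And>i y z. i \<in> R \<Longrightarrow> y \<in> Y \<Longrightarrow> z \<in> Y \<Longrightarrow> m y z \<in> Y \<and> u i (m y z) = u i y * u i z"
    and nz: "\<And>i. i \<in> R \<Longrightarrow> \<exists>y\<in>Y. u i y \<noteq> 0"
    and "\<And>i j. i \<in> R \<Longrightarrow> j \<in> R \<Longrightarrow> i \<noteq> j \<Longrightarrow> \<exists>y\<in>Y. u i y \<noteq> u j y"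
    and "\<And>y. y \<in> Y \<Longrightarrow> (\<Sum>i\<in>R. C i * u i y) = 0"
  shows "\<forall>i\<in>R. C i = 0"
  using assms
proof (induction R arbitrary: C rule: finite_induct)
  case (insert i R)
  have R0: "C j = 0" if j: "j \<in> R" for j
  proof -
    obtain y0 where y0: "y0 \<in> Y" "u i y0 \<noteq> u j y0"
      using insert.prems(3)[of i j] insert.hyps j by auto
    have "(\<Sum>l\<in>R. C l * (u l y0 - u i y0) * u l y) = 0" if y: "y \<in> Y" for y
    proof -
      have *: "m y0 y \<in> Y" "\<And>l. l \<in> insert i R \<Longrightarrow> u l (m y0 y) = u l y0 * u l y"
        using insert.prems(1) y y0 by blast+
      have "(\<Sum>l\<in>insert i R. C l * u l (m y0 y)) - u i y0 * (\<Sum>l\<in>insert i R. C l * u l y) = 0"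
        using insert.prems(4)[OF *(1)] insert.prems(4)[OF y] by simp
      also have "(\<Sum>l\<in>insert i R. C l * u l (m y0 y)) - u i y0 * (\<Sum>l\<in>insert i R. C l * u l y)
          = (\<Sum>l\<in>insert i R. C l * (u l y0 - u i y0) * u l y)"
        unfolding sum_distrib_left sum_subtractf[symmetric]
        by (rule sum.cong) (simp_all add: * algebra_simps)
      finally show ?thesis using insert.hyps by simp
    qed
    then have "\<forall>l\<in>R. C l * (u l y0 - u i y0) = 0"
      by (intro insert.IH) (use insert.prems in blast)+
    then show ?thesis using j y0(2) by auto
  qed
  obtain y where y: "y \<in> Y" "u i y \<noteq> 0" using insert.prems(2) by blast
  have "(\<Sum>l\<in>insert i R. C l * u l y) = C i * u i y"
    using insert.hyps R0 by (simp add: sum.neutral)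
  then show ?case using insert.prems(4)[OF y(1)] y(2) R0 by auto
qed simp

text \<open>
  By hypothesis, equivalent monomials agree modulo \<open>J\<close> up to a power of \<open>t\<^sub>k\<close>. So, up to such a
  power, \<open>f\<close> can be rewritten in terms of one representative for each class, whose coefficient is
  the sum of the coefficients in the class. Inequivalent monomials of the same degree are distinct
  multiplicative functions on \<open>Y\<close>, so these sums are zero.
\<close>

lemma homogeneous_vanishing_saturated:
  fixes Y :: "('a::field ^ 's::finite) set" and J :: "('s, 'a) mvpoly set"
  assumes J: "ideal J mvpoly_ring"
    and Y1: "(\<chi> i. 1) \<in> Y" and Ymult: "\<And>y z. y \<in> Y \<Longrightarrow> z \<in> Y \<Longrightarrow> (\<chi> i. y $ i * z $ i) \<in> Y"
    and same: "\<And>f g. same_on Y f g \<Longrightarrow> \<exists>N. mv_var k ^ N * (tpow f - tpow g) \<in> J"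
    and f: "homogeneous_deg d f" "\<And>y. y \<in> Y \<Longrightarrow> mv_eval f y = 0"
  shows "\<exists>N. mv_var k ^ N * f \<in> J"
proof -
  let ?l = Poly_Mapping.lookup
  define A where "A = Poly_Mapping.keys f"
  define rep where "rep a = (SOME b. b \<in> A \<and> same_on Y (?l b) (?l a))" for a
  have rep: "rep a \<in> A" "same_on Y (?l (rep a)) (?l a)" if "a \<in> A" for a
    using someI[of "\<lambda>b. b \<in> A \<and> same_on Y (?l b) (?l a)" a] that unfolding rep_def
    by (simp_all add: same_on_def)
  have rep_eq: "rep a = rep b" if "same_on Y (?l a) (?l b)" for a b
  proof -
    have "(\<lambda>c. c \<in> A \<and> same_on Y (?l c) (?l a)) = (\<lambda>c. c \<in> A \<and> same_on Y (?l c) (?l b))"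
      using that by (auto simp: same_on_def)
    then show ?thesis by (simp add: rep_def)
  qed
  define C where "C b = (\<Sum>a\<in>{a \<in> A. rep a = b}. ?l f a)" for b
  have group: "(\<Sum>a\<in>A. h (?l f a) * w (rep a)) = (\<Sum>b\<in>rep ` A. (\<Sum>a\<in>{a \<in> A. rep a = b}. h (?l f a)) * w b)"
    for h :: "'a \<Rightarrow> 'r::comm_ring_1" and w
    by (subst sum.image_gen[of A _ rep]) (simp_all add: A_def sum_distrib_right)
  have "\<forall>b\<in>rep ` A. C b = 0"
  proof (rule multiplicative_independent[of _ Y "\<lambda>y z. \<chi> i. y $ i * z $ i" "\<lambda>b y. vpow y (?l b)"])
    show "(\<chi> i. y $ i * z $ i) \<in> Y \<and> vpow (\<chi> i. y $ i * z $ i) (?l b) = vpow y (?l b) * vpow z (?l b)"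
      if "y \<in> Y" "z \<in> Y" for b y z
      using Ymult[OF that] by (simp add: vpow_def power_mult_distrib prod.distrib)
    show "\<exists>y\<in>Y. vpow y (?l b) \<noteq> 0" for b
      by (rule bexI[OF _ Y1]) (simp add: vpow_def)
    fix b b' assume b: "b \<in> rep ` A" "b' \<in> rep ` A" "b \<noteq> b'"
    show "\<exists>y\<in>Y. vpow y (?l b) \<noteq> vpow y (?l b')"
    proof (rule ccontr)
      assume "\<not> ?thesis"
      moreover have "b \<in> A" "b' \<in> A" using b rep by auto
      ultimately have "same_on Y (?l b) (?l b')"
        using f(1) unfolding same_on_def homogeneous_deg_def A_def by simp
      then have "rep b = rep b'" by (rule rep_eq)
      moreover have "rep b = b" "rep b' = b'" using b rep_eq rep(2) by auto
      ultimately show False using b by simp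
    qed
  next
    fix y assume y: "y \<in> Y"
    have "(\<Sum>b\<in>rep ` A. C b * vpow y (?l b)) = (\<Sum>a\<in>A. ?l f a * vpow y (?l (rep a)))"
      using group[of "\<lambda>c. c" "\<lambda>b. vpow y (?l b)"] by (simp add: C_def)
    also have "\<dots> = (\<Sum>a\<in>A. ?l f a * vpow y (?l a))"
      using rep(2) y by (intro sum.cong) (auto simp: same_on_def)
    also have "\<dots> = mv_eval f y" by (simp add: mv_eval_def vpow_def A_def)
    finally show "(\<Sum>b\<in>rep ` A. C b * vpow y (?l b)) = 0" using f(2)[OF y] by simp
  qed (simp add: A_def)
  moreover have "(\<Sum>a\<in>{a \<in> A. rep a = b}. mv_const (?l f a)) = (mv_const (C b) :: ('s, 'a) mvpoly)" for b
  proof -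
    have "(\<Sum>a\<in>B. mv_const (?l f a)) = (mv_const (sum (?l f) B) :: ('s, 'a) mvpoly)" for B
      by (induction B rule: infinite_finite_induct) simp_all
    then show ?thesis by (simp add: C_def)
  qed
  ultimately have zero: "(\<Sum>a\<in>A. mv_const (?l f a) * tpow (?l (rep a))) = 0"
    unfolding group[of mv_const "\<lambda>b. tpow (?l b)"] by (intro sum.neutral) simp
  have "\<exists>N. mv_var k ^ N * (tpow (?l a) - tpow (?l (rep a))) \<in> J" if "a \<in> A" for a
    using same[of "?l a" "?l (rep a)"] rep(2)[OF that] by (simp add: same_on_def)
  then obtain N where N: "\<And>a. a \<in> A \<Longrightarrow> mv_var k ^ N a * (tpow (?l a) - tpow (?l (rep a))) \<in> J"
    by metis
  define M where "M = (\<Sum>a\<in>A. N a)"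
  have M: "mv_var k ^ M * (mv_const (?l f a) * (tpow (?l a) - tpow (?l (rep a)))) \<in> J" if a: "a \<in> A" for a
  proof -
    have "N a \<le> M" unfolding M_def using a by (intro member_le_sum) (auto simp: A_def)
    then have split: "(mv_var k :: ('s, 'a) mvpoly) ^ M = mv_var k ^ (M - N a) * mv_var k ^ N a"
      by (simp flip: power_add)
    have "mv_var k ^ M * (mv_const (?l f a) * (tpow (?l a) - tpow (?l (rep a))))
      = (mv_var k ^ (M - N a) * mv_const (?l f a)) * (mv_var k ^ N a * (tpow (?l a) - tpow (?l (rep a))))"
      unfolding split by (simp only: mult_ac)
    then show ?thesis using ideal_mult[OF J N[OF a]] by simp
  qed
  have "f = (\<Sum>a\<in>A. mv_const (?l f a) * tpow (?l a)) - (\<Sum>a\<in>A. mv_const (?l f a) * tpow (?l (rep a)))"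
    using mv_expansion[of f] zero by (simp add: A_def mv_monom_lookup)
  also have "\<dots> = (\<Sum>a\<in>A. mv_const (?l f a) * (tpow (?l a) - tpow (?l (rep a))))"
    by (simp add: sum_subtractf right_diff_distrib)
  finally have "mv_var k ^ M * f = (\<Sum>a\<in>A. mv_var k ^ M * (mv_const (?l f a) * (tpow (?l a) - tpow (?l (rep a)))))"
    unfolding sum_distrib_left[symmetric] by (rule arg_cong)
  moreover have "(\<Sum>a\<in>A. mv_var k ^ M * (mv_const (?l f a) * (tpow (?l a) - tpow (?l (rep a))))) \<in> J"
    by (rule ideal_sum[OF J M])
  ultimately have "mv_var k ^ M * f \<in> J" by (rule ssubst)
  then show ?thesis ..
qed


section \<open>Binomials that eliminate one variable\<close>

lemma subtractive_set_multiples: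
  fixes R :: "nat \<Rightarrow> bool"
  assumes sub: "\<And>m n. R m \<Longrightarrow> R n \<Longrightarrow> n \<le> m \<Longrightarrow> R (m - n)" and "R d0" "d0 > 0"
  shows "\<exists>d>0. R d \<and> (\<forall>m. R m \<longrightarrow> d dvd m)"
proof -
  define d where "d = (LEAST d. d > 0 \<and> R d)"
  have d: "d > 0 \<and> R d" unfolding d_def by (rule LeastI[of _ d0]) (use assms(2,3) in simp)
  have min: "d \<le> m" if "R m" "m > 0" for m unfolding d_def by (rule Least_le) (use that in simp)
  have "d dvd m" if "R m" for m
    using that
  proof (induction m rule: less_induct)
    case (less m)
    show ?case
    proof (cases "m = 0")
      case False
      then have "d \<le> m" using min less.prems by simp
      then have "d dvd m - d" using less.IH[of "m - d"] sub[of m d] less.prems d False by simp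
      then show ?thesis using \<open>d \<le> m\<close> by (metis dvd_diffD dvd_refl)
    qed simp
  qed
  then show ?thesis using d by blast
qed

lemma finite_field_power_card_minus_1:
  fixes y :: "'a::{field,finite}"
  assumes "y \<noteq> 0"
  shows "y ^ (CARD('a) - 1) = 1"
proof -
  have "bij_betw ((*) y) (UNIV - {0}) (UNIV - {0})"
    by (rule bij_betwI[of _ _ _ "\<lambda>x. x / y"]) (use assms in auto)
  then have "(\<Prod>x\<in>UNIV - {0}. y * x) = \<Prod>(UNIV - {0 :: 'a})"
    by (rule prod.reindex_bij_betw)
  then have "y ^ (CARD('a) - 1) * \<Prod>(UNIV - {0 :: 'a}) = \<Prod>(UNIV - {0 :: 'a})"
    by (simp add: prod.distrib card_Diff_singleton)
  moreover have "\<Prod>(UNIV - {0 :: 'a}) \<noteq> 0" by simp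
  ultimately show ?thesis by simp
qed

lemma card_field_ge_2: "CARD('a::{field,finite}) \<ge> 2"
  using card_mono[of "UNIV :: 'a set" "{0, 1}"] by simp

lemma prime_CHAR_finite_field: "Factorial_Ring.prime CHAR('a::{field,finite})"
  using prime_CHAR_semidom finite_imp_CHAR_pos[where ?'a = 'a] by simp

text \<open>
  Such powers \<open>P\<close> serve two purposes: raising to the power \<open>P\<close> is additive, being a power of the
  Frobenius map, and it fixes every element of the field, as \<open>q - 1\<close> divides \<open>P - 1\<close>. They exist by
  Euler's theorem, since \<open>p\<close> divides \<open>q\<close> and is therefore coprime to \<open>q - 1\<close>.
\<close>

lemma large_power_of_char:
  obtains e w where "CHAR('a::{field,finite}) ^ e = Suc ((CARD('a) - 1) * w)" "n \<le> w"
proof -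
  define q1 where "q1 = CARD('a) - 1"
  have q1: "q1 > 0" "CARD('a) = Suc q1" using card_field_ge_2[where ?'a = 'a] by (auto simp: q1_def)
  have p: "Factorial_Ring.prime CHAR('a)" by (rule prime_CHAR_finite_field)
  have "coprime CHAR('a) q1"
  proof (rule prime_imp_coprime[OF p])
    show "\<not> CHAR('a) dvd q1"
    proof
      assume "CHAR('a) dvd q1"
      moreover have "CHAR('a) dvd Suc q1" using CHAR_dvd_CARD[where ?'a = 'a] q1 by simp
      ultimately have "CHAR('a) dvd 1" using dvd_diff_nat[of "CHAR('a)" "Suc q1" q1] by simp
      then show False using p by auto
    qed
  qed
  then have "[(CHAR('a) ^ totient q1) ^ (q1 * n) = 1 ^ (q1 * n)] (mod q1)"
    by (intro cong_pow euler_theorem)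
  then have "[CHAR('a) ^ (totient q1 * (q1 * n)) = 1] (mod q1)"
    by (simp add: power_mult)
  moreover have pos: "1 \<le> CHAR('a) ^ (totient q1 * (q1 * n))"
    using prime_gt_0_nat[OF p] by (simp add: Suc_le_eq)
  ultimately have "q1 dvd CHAR('a) ^ (totient q1 * (q1 * n)) - 1"
    by (simp add: cong_altdef_nat)
  then obtain w where "CHAR('a) ^ (totient q1 * (q1 * n)) - 1 = q1 * w" by (rule dvdE)
  then have w: "CHAR('a) ^ (totient q1 * (q1 * n)) = Suc (q1 * w)" using pos by simp
  have "q1 * n < 2 ^ (q1 * n)" by (rule less_exp)
  also have "2 ^ (q1 * n) \<le> CHAR('a) ^ (totient q1 * (q1 * n))"
  proof (rule order_trans)
    show "2 ^ (q1 * n) \<le> CHAR('a) ^ (q1 * n)" using prime_ge_2_nat[OF p] by (rule power_mono) simp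
    have "1 \<le> totient q1" using q1 by (simp add: Suc_le_eq)
    then have "1 * (q1 * n) \<le> totient q1 * (q1 * n)" by (rule mult_le_mono1)
    then show "CHAR('a) ^ (q1 * n) \<le> CHAR('a) ^ (totient q1 * (q1 * n))"
      using prime_ge_2_nat[OF p] by (intro power_increasing) (simp_all only: mult_1)
  qed
  finally have "n \<le> w" using q1 by (simp add: w less_Suc_eq_le)
  with w show ?thesis using that unfolding q1_def by blast
qed

lemma frobenius_diff:
  fixes x y :: "('s, 'a::{field,finite}) mvpoly"
  shows "(x - y) ^ (CHAR('a) ^ e) = x ^ (CHAR('a) ^ e) - y ^ (CHAR('a) ^ e)"
proof -
  have "CHAR(('s, 'a) mvpoly) = CHAR('a)"
  proof (rule CHAR_eqI)
    have of_nat: "(of_nat n :: ('s, 'a) mvpoly) = Poly_Mapping.single 0 (of_nat n)" for n by simp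
    show "of_nat CHAR('a) = (0 :: ('s, 'a) mvpoly)" unfolding of_nat by (simp del: single_of_nat)
    show "CHAR('a) dvd n" if "of_nat n = (0 :: ('s, 'a) mvpoly)" for n
    proof -
      have "Poly_Mapping.lookup (of_nat n :: ('s, 'a) mvpoly) 0 = 0" using that by simp
      then show ?thesis unfolding of_nat by (simp add: of_nat_eq_0_iff_char_dvd del: single_of_nat)
    qed
  qed
  then have "((x - y) + y) ^ (CHAR('a) ^ e) = (x - y) ^ (CHAR('a) ^ e) + y ^ (CHAR('a) ^ e)"
    using prime_CHAR_finite_field[where ?'a = 'a] by (intro freshmans_dream') simp_all
  then show ?thesis by simp
qed

text \<open>
  The data describe the binomial \<open>t\<^sub>j\<^sup>D - t\<^sup>b\<close>, where \<open>D\<close> is \<open>d\<close> times a power of the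
  characteristic and \<open>b\<close> is supported on \<open>S\<close>. It is homogeneous and vanishes on \<open>Y\<close>. The last clause
  lets it reduce equivalent monomials in the variables \<open>S \<union> {j}\<close>: once both are raised to that
  power of the characteristic, their exponents of \<open>t\<^sub>j\<close> differ by a multiple of \<open>D\<close>.
\<close>

definition reducing_binomial ::
  "('a::{field,finite} ^ 's::finite) set \<Rightarrow> 's set \<Rightarrow> 's \<Rightarrow> nat \<Rightarrow> nat \<Rightarrow> ('s \<Rightarrow> nat) \<Rightarrow> bool" where
  "reducing_binomial Y S j d e b \<longleftrightarrow>
    d > 0 \<and> (\<forall>i. i \<notin> S \<longrightarrow> b i = 0) \<and> sum b UNIV = d * CHAR('a) ^ e \<and>
    (\<forall>y\<in>Y. vpow y b = y $ j ^ (d * CHAR('a) ^ e)) \<and>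
    (\<forall>f g. (\<forall>i. i \<notin> insert j S \<longrightarrow> f i = 0 \<and> g i = 0) \<longrightarrow> same_on Y f g \<longrightarrow>
       g j \<le> f j \<longrightarrow> d dvd f j - g j)"

text \<open>
  Let \<open>R n\<close> say that \<open>t\<^sub>j\<^sup>n t\<^sup>f\<close> is equivalent to \<open>t\<^sup>g\<close> for some \<open>f\<close> and \<open>g\<close> supported on \<open>S\<close>. Such \<open>n\<close> can be
  subtracted from each other, and \<open>q - 1\<close> is one of them, so they are multiples of a least positive
  one, \<open>d\<close>. As functions on \<open>Y\<close>, \<open>t\<^sub>j\<^sup>d\<close> equals \<open>t\<^sup>g\<close> divided by \<open>t\<^sup>f\<close>. The division is turned into a
  multiplication by the \<open>(q - 2)\<close>-nd power of \<open>t\<^sup>f\<close>, which spoils the degree. Passing from \<open>d\<close> to \<open>d P\<close> makes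
  room to repair it with a power of \<open>t\<^sub>k\<close> whose exponent is a multiple of \<open>q - 1\<close>.
\<close>

lemma exists_reducing_binomial:
  fixes Y :: "('a::{field,finite} ^ 's::finite) set"
  assumes nz: "\<And>y i. y \<in> Y \<Longrightarrow> y $ i \<noteq> 0" and k: "k \<in> S"
  shows "\<exists>d e b. reducing_binomial Y S j d e b"
proof -
  define q1 where "q1 = CARD('a) - 1"
  have q1: "q1 > 0" using card_field_ge_2[where ?'a = 'a] by (auto simp: q1_def)
  have pow_q1: "y $ i ^ q1 = 1" "vpow y f ^ q1 = 1" if "y \<in> Y" for y :: "'a ^ 's" and i f
    using finite_field_power_card_minus_1 nz[OF that] vpow_nonzero[of y] by (auto simp: q1_def)
  define R where "R n \<longleftrightarrow> (\<exists>f g. (\<forall>i. i \<notin> S \<longrightarrow> f i = 0 \<and> g i = 0) \<and>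
    n + sum f UNIV = sum g UNIV \<and> (\<forall>y\<in>Y. y $ j ^ n * vpow y f = vpow y g))" for n
  have "R (m - n)" if "R m" "R n" "n \<le> m" for m n
  proof -
    obtain f g where fg: "\<forall>i. i \<notin> S \<longrightarrow> f i = 0 \<and> g i = 0" "m + sum f UNIV = sum g UNIV"
      "\<forall>y\<in>Y. y $ j ^ m * vpow y f = vpow y g" using \<open>R m\<close> unfolding R_def by blast
    obtain f' g' where fg': "\<forall>i. i \<notin> S \<longrightarrow> f' i = 0 \<and> g' i = 0" "n + sum f' UNIV = sum g' UNIV"
      "\<forall>y\<in>Y. y $ j ^ n * vpow y f' = vpow y g'" using \<open>R n\<close> unfolding R_def by blast
    have "y $ j ^ (m - n) * vpow y (\<lambda>i. f i + g' i) = vpow y (\<lambda>i. g i + f' i)" if y: "y \<in> Y" for y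
    proof -
      have "y $ j ^ (m - n) * vpow y (\<lambda>i. f i + g' i) = y $ j ^ (m - n) * y $ j ^ n * vpow y f * vpow y f'"
        using fg'(3)[rule_format, OF y, symmetric] by (simp add: vpow_add mult_ac)
      also have "y $ j ^ (m - n) * y $ j ^ n = y $ j ^ m" using \<open>n \<le> m\<close> by (simp flip: power_add)
      finally show ?thesis using fg(3) y by (simp add: vpow_add)
    qed
    moreover have "m - n + (\<Sum>i\<in>UNIV. f i + g' i) = (\<Sum>i\<in>UNIV. g i + f' i)"
      using fg(2) fg'(2) \<open>n \<le> m\<close> by (simp add: sum.distrib)
    ultimately show ?thesis unfolding R_def using fg(1) fg'(1)
      by (intro exI[of _ "\<lambda>i. f i + g' i"] exI[of _ "\<lambda>i. g i + f' i"]) simp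
  qed
  moreover have "R q1"
    unfolding R_def
    by (rule exI[of _ "\<lambda>_. 0"], rule exI[of _ "\<lambda>i. if i = k then q1 else 0"])
      (use k pow_q1 in \<open>auto simp: vpow_single, simp add: vpow_def\<close>)
  ultimately have "\<exists>d>0. R d \<and> (\<forall>m. R m \<longrightarrow> d dvd m)"
    using q1 by (rule subtractive_set_multiples)
  then obtain d where d: "d > 0" "R d" "\<And>m. R m \<Longrightarrow> d dvd m" by blast
  obtain f g where fg: "\<forall>i. i \<notin> S \<longrightarrow> f i = 0 \<and> g i = 0" "d + sum f UNIV = sum g UNIV"
    "\<forall>y\<in>Y. y $ j ^ d * vpow y f = vpow y g" using \<open>R d\<close> unfolding R_def by blast
  obtain e w where w: "CHAR('a) ^ e = Suc (q1 * w)" "sum f UNIV \<le> w"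
    using large_power_of_char[where ?'a = 'a] unfolding q1_def by metis
  define M where "M = d * w - sum f UNIV"
  have M: "M + sum f UNIV = d * w"
  proof -
    have "w \<le> d * w" using d(1) by simp
    with w(2) have "sum f UNIV \<le> d * w" by (rule order_trans)
    then show ?thesis unfolding M_def by (rule le_add_diff_inverse2)
  qed
  \<comment> \<open>On \<open>Y\<close> the summand \<open>(q1 - 1) * f i\<close> accounts for \<open>- f i\<close>, and the last one only adjusts the degree.\<close>
  define b where "b = (\<lambda>i. (g i + (q1 - 1) * f i) + q1 * (if i = k then M else 0))"
  have "sum b UNIV = sum g UNIV + (q1 - 1) * sum f UNIV + q1 * M"
    by (simp add: b_def sum.distrib sum.delta flip: sum_distrib_left)
  also have "\<dots> = d + (sum f UNIV + (q1 - 1) * sum f UNIV) + q1 * M" using fg(2) by simp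
  also have "sum f UNIV + (q1 - 1) * sum f UNIV = q1 * sum f UNIV"
    using q1 by (cases q1) auto
  also have "d + q1 * sum f UNIV + q1 * M = d + q1 * (M + sum f UNIV)" by (simp add: algebra_simps)
  finally have deg: "sum b UNIV = d * CHAR('a) ^ e" by (simp add: M w(1) algebra_simps)
  have val: "vpow y b = y $ j ^ (d * CHAR('a) ^ e)" if y: "y \<in> Y" for y
  proof -
    have "vpow y b = vpow y g * vpow y f ^ (q1 - 1) * (y $ k ^ M) ^ q1"
      unfolding b_def vpow_add vpow_mult vpow_single ..
    also have "(y $ k ^ M) ^ q1 = (y $ k ^ q1) ^ M" by (simp add: mult.commute flip: power_mult)
    also have "\<dots> = 1" using pow_q1(1)[OF y, of k] by simp
    also have "vpow y g = y $ j ^ d * vpow y f" using fg(3) y by simp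
    also have "y $ j ^ d * vpow y f * vpow y f ^ (q1 - 1) * 1 = y $ j ^ d * vpow y f ^ q1"
      using q1 by (cases q1) auto
    also have "\<dots> = y $ j ^ d" using pow_q1(2)[OF y] by simp
    also have "\<dots> = y $ j ^ (d * CHAR('a) ^ e)"
    proof -
      have "y $ j ^ CHAR('a) ^ e = y $ j" using pow_q1(1)[OF y, of j] by (simp add: w(1) power_mult)
      then show ?thesis by (metis mult.commute power_mult)
    qed
    finally show ?thesis .
  qed
  have min: "d dvd f j - g j" if fg: "\<And>i. i \<notin> insert j S \<Longrightarrow> f i = 0" "\<And>i. i \<notin> insert j S \<Longrightarrow> g i = 0"
    "same_on Y f g" "g j \<le> f j" for f g
  proof (rule d(3))
    have "y $ j ^ (f j - g j) * vpow y (f(j := 0)) = vpow y (g(j := 0))" if y: "y \<in> Y" for y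
    proof -
      have split: "vpow y f = y $ j ^ f j * vpow y (f(j := 0))" for f
        by (subst split_exponent[of f j]) (simp only: vpow_add vpow_single)
      have "y $ j ^ g j * (y $ j ^ (f j - g j) * vpow y (f(j := 0))) = y $ j ^ f j * vpow y (f(j := 0))"
        using fg(4) by (simp flip: power_add mult.assoc)
      also have "\<dots> = y $ j ^ g j * vpow y (g(j := 0))"
        using fg(3) y split[of f] split[of g] by (simp add: same_on_def)
      finally show ?thesis using nz[OF y] by simp
    qed
    moreover have "f j - g j + sum (f(j := 0)) UNIV = sum (g(j := 0)) UNIV"
    proof -
      have "sum f UNIV = f j + sum (f(j := 0)) UNIV" for f :: "'s \<Rightarrow> nat"
        by (subst split_exponent[of f j]) (simp only: sum.distrib sum.delta finite UNIV_I if_True)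
      then show ?thesis using fg(3,4) unfolding same_on_def by (metis add_diff_assoc2 add_diff_cancel_left')
    qed
    ultimately show "R (f j - g j)"
      unfolding R_def using fg(1,2)
      by (intro exI[of _ "f(j := 0)"] exI[of _ "g(j := 0)"]) auto
  qed
  have "b i = 0" if "i \<notin> S" for i using that fg(1) k by (auto simp: b_def)
  then have "reducing_binomial Y S j d e b"
    unfolding reducing_binomial_def using d(1) deg val min by blast
  then show ?thesis by blast
qed

section \<open>The radical of the ideal of the binomials\<close>

definition radical_ideal :: "'r::comm_ring_1 set \<Rightarrow> bool" where
  "radical_ideal J \<longleftrightarrow> ideal J ring_of_type_algebra \<and> (\<forall>x n. n > 0 \<longrightarrow> x ^ n \<in> J \<longrightarrow> x \<in> J)"

text \<open>
  The exponents of \<open>t\<^sub>j\<close> in \<open>f\<close> and \<open>g\<close> differ by a multiple of \<open>d\<close>, so those in the \<open>P\<close>-th powers of the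
  two monomials differ by a multiple of \<open>d P\<close>, where \<open>P\<close> is the power of the characteristic in the
  given binomial. After cancelling the common power of \<open>t\<^sub>j\<close>, the binomial
  rewrites the rest in terms of the variables in \<open>S\<close>, to which the induction hypothesis applies. By
  the Frobenius map this settles the \<open>P\<close>-th power of \<open>t\<^sup>f - t\<^sup>g\<close>, and radicality the difference itself.
\<close>

lemma extend_same_on:
  fixes Y :: "('a::{field,finite} ^ 's::finite) set" and J :: "('s, 'a) mvpoly set"
  assumes nz: "\<And>y i. y \<in> Y \<Longrightarrow> y $ i \<noteq> 0" and J: "radical_ideal J"
    and b: "reducing_binomial Y S j d e b"
    and mem: "mv_var j ^ (d * CHAR('a) ^ e) - tpow b \<in> J"
    and IH: "\<And>f g. \<lbrakk>\<And>i. i \<notin> S \<Longrightarrow> f i = 0; \<And>i. i \<notin> S \<Longrightarrow> g i = 0; same_on Y f g\<rbrakk>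
      \<Longrightarrow> \<exists>N. mv_var k ^ N * (tpow f - tpow g) \<in> J"
    and fg: "\<And>i. i \<notin> insert j S \<Longrightarrow> f i = 0" "\<And>i. i \<notin> insert j S \<Longrightarrow> g i = 0" "same_on Y f g"
  shows "\<exists>N. mv_var k ^ N * (tpow f - tpow g) \<in> J"
proof -
  have b: "\<And>i. i \<notin> S \<Longrightarrow> b i = 0" "sum b UNIV = d * CHAR('a) ^ e"
      "\<And>y. y \<in> Y \<Longrightarrow> vpow y b = y $ j ^ (d * CHAR('a) ^ e)"
    and d: "\<And>f g. \<lbrakk>\<And>i. i \<notin> insert j S \<Longrightarrow> f i = 0; \<And>i. i \<notin> insert j S \<Longrightarrow> g i = 0; same_on Y f g; g j \<le> f j\<rbrakk>
      \<Longrightarrow> d dvd f j - g j"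
    using b unfolding reducing_binomial_def by blast+
  have I: "ideal J mvpoly_ring" using J by (simp add: radical_ideal_def)
  define P where "P = CHAR('a) ^ e"
  have P: "P > 0" using prime_CHAR_finite_field[where ?'a = 'a] by (simp add: P_def prime_gt_0_nat)
  have main: "\<exists>N. mv_var k ^ N * (tpow f - tpow g) \<in> J"
    if fg: "\<And>i. i \<notin> insert j S \<Longrightarrow> f i = 0" "\<And>i. i \<notin> insert j S \<Longrightarrow> g i = 0" "same_on Y f g"
      and le: "g j \<le> f j" for f g
  proof -
    obtain m where m: "f j - g j = d * m" using d[OF fg le] by (auto elim: dvdE)
    then have fj: "f j = g j + d * m" using le by simp
    let ?f = "f(j := 0)" and ?g = "g(j := 0)"
    \<comment> \<open>the exponents that remain after the reduction\<close>
    define f1 where "f1 = (\<lambda>i. m * b i + P * ?f i)"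
    define g1 where "g1 = (\<lambda>i. P * ?g i)"
    have deg_split: "sum f UNIV = f j + sum (f(j := 0)) UNIV" for f :: "'s \<Rightarrow> nat"
      by (subst split_exponent[of f j]) (simp only: sum.distrib sum.delta finite UNIV_I if_True)
    have vpow_split: "vpow y f = y $ j ^ f j * vpow y (f(j := 0))" for f and y :: "'a ^ 's"
      by (subst split_exponent[of f j]) (simp only: vpow_add vpow_single)
    have tpow_split: "tpow f = (mv_var j ^ f j * tpow (f(j := 0)) :: ('s, 'a) mvpoly)" for f
      by (subst split_exponent[of f j]) (simp only: tpow_add tpow_var)
    have "d * m + sum ?f UNIV = sum ?g UNIV"
      using fg(3) deg_split[of f] deg_split[of g] fj by (simp add: same_on_def)
    moreover have "sum f1 UNIV = P * (d * m + sum ?f UNIV)" "sum g1 UNIV = P * sum ?g UNIV"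
      unfolding f1_def g1_def sum.distrib sum_distrib_left[symmetric] b(2) P_def[symmetric]
      by (simp_all only: distrib_left mult_ac)
    ultimately have "sum f1 UNIV = sum g1 UNIV" by simp
    moreover have "vpow y f1 = vpow y g1" if y: "y \<in> Y" for y
    proof -
      have "y $ j ^ g j * (y $ j ^ (d * m) * vpow y ?f) = vpow y f"
        unfolding vpow_split[of y f] fj power_add by (simp only: mult.assoc)
      also have "\<dots> = y $ j ^ g j * vpow y ?g"
        using fg(3) y vpow_split[of y g] by (simp add: same_on_def)
      finally have "y $ j ^ g j * (y $ j ^ (d * m) * vpow y ?f) = y $ j ^ g j * vpow y ?g" .
      then have eq: "y $ j ^ (d * m) * vpow y ?f = vpow y ?g" using nz[OF y] by simp
      have "vpow y f1 = (y $ j ^ (d * P)) ^ m * vpow y ?f ^ P"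
        unfolding f1_def vpow_add vpow_mult b(3)[OF y] P_def ..
      also have "\<dots> = (y $ j ^ (d * m) * vpow y ?f) ^ P"
        by (simp add: power_mult_distrib mult_ac flip: power_mult)
      finally show ?thesis unfolding eq g1_def vpow_mult .
    qed
    ultimately have "same_on Y f1 g1" by (simp add: same_on_def)
    moreover have "f1 i = 0" "g1 i = 0" if "i \<notin> S" for i
      using that b(1) fg(1,2) by (auto simp: f1_def g1_def)
    ultimately obtain N where N: "mv_var k ^ N * (tpow f1 - tpow g1) \<in> J" using IH by blast
    have tf1: "tpow f1 = (tpow b ^ m * tpow ?f ^ P :: ('s, 'a) mvpoly)"
      and tg1: "tpow g1 = (tpow ?g ^ P :: ('s, 'a) mvpoly)"
      unfolding f1_def g1_def tpow_add tpow_mult by (rule refl)+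
    have "(tpow f - tpow g :: ('s, 'a) mvpoly) ^ P = tpow f ^ P - tpow g ^ P"
      unfolding P_def by (rule frobenius_diff)
    also have "(tpow f :: ('s, 'a) mvpoly) ^ P = (mv_var j ^ g j) ^ P * ((mv_var j ^ (d * P)) ^ m * tpow ?f ^ P)"
      unfolding tpow_split[of f] fj power_add power_mult_distrib by (simp add: mult_ac flip: power_mult)
    also have "(tpow g :: ('s, 'a) mvpoly) ^ P = (mv_var j ^ g j) ^ P * tpow ?g ^ P"
      unfolding tpow_split[of g] power_mult_distrib ..
    also have "(mv_var j ^ g j :: ('s, 'a) mvpoly) ^ P * ((mv_var j ^ (d * P)) ^ m * tpow ?f ^ P) - (mv_var j ^ g j) ^ P * tpow ?g ^ P
      = (mv_var j ^ g j) ^ P * (((mv_var j ^ (d * P)) ^ m - tpow b ^ m) * tpow ?f ^ P + (tpow f1 - tpow g1))"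
    proof -
      have "c * (x * u) - c * w = c * ((x - z) * u + (z * u - w))" for c x u w z :: "('s, 'a) mvpoly"
        by (simp add: algebra_simps)
      then show ?thesis unfolding tf1 tg1 .
    qed
    finally have frob: "(tpow f - tpow g :: ('s, 'a) mvpoly) ^ P = (mv_var j ^ g j) ^ P *
        (((mv_var j ^ (d * P)) ^ m - tpow b ^ m) * tpow ?f ^ P + (tpow f1 - tpow g1))" .
    have "mv_var j ^ (d * P) - tpow b \<in> J" using mem by (simp add: P_def)
    then have 1: "(mv_var j ^ (d * P)) ^ m - tpow b ^ m \<in> J"
      by (rule power_cong_mod_ideal[OF I])
    have "mv_var k ^ N * (tpow f - tpow g :: ('s, 'a) mvpoly) ^ P = (mv_var j ^ g j) ^ P *
        (mv_var k ^ N * tpow ?f ^ P * ((mv_var j ^ (d * P)) ^ m - tpow b ^ m) + mv_var k ^ N * (tpow f1 - tpow g1))"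
      unfolding frob by (simp add: algebra_simps)
    also have "\<dots> \<in> J" by (intro ideal_mult[OF I] ideal_add[OF I] 1 N)
    finally have "mv_var k ^ (N * (P - 1)) * (mv_var k ^ N * (tpow f - tpow g) ^ P) \<in> J"
      by (rule ideal_mult[OF I])
    also have "mv_var k ^ (N * (P - 1)) * (mv_var k ^ N * (tpow f - tpow g :: ('s, 'a) mvpoly) ^ P)
        = (mv_var k ^ N * (tpow f - tpow g)) ^ P"
    proof -
      have "N * (P - 1) + N = N * P" using P by (cases P) auto
      then have "(mv_var k :: ('s, 'a) mvpoly) ^ (N * (P - 1)) * mv_var k ^ N = (mv_var k ^ N) ^ P"
        by (simp flip: power_add power_mult)
      then show ?thesis by (simp add: power_mult_distrib flip: mult.assoc)
    qed
    finally have "mv_var k ^ N * (tpow f - tpow g) \<in> J" using J P unfolding radical_ideal_def by blast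
    then show ?thesis ..
  qed
  show ?thesis
  proof (cases "g j \<le> f j")
    case True
    then show ?thesis using main fg by blast
  next
    case False
    moreover have "same_on Y g f" using fg(3) by (simp add: same_on_def)
    ultimately obtain N where "mv_var k ^ N * (tpow g - tpow f) \<in> J"
      using main[of g f] fg(1,2) by fastforce
    then have "- (mv_var k ^ N * (tpow g - tpow f)) \<in> J" by (rule ideal_uminus[OF I])
    then show ?thesis by (intro exI[of _ N]) (simp add: algebra_simps)
  qed
qed

lemma colon_ideal:
  fixes J :: "'r::comm_ring_1 set"
  assumes J: "ideal J ring_of_type_algebra"
  shows "ideal {h. h * f \<in> J} ring_of_type_algebra"
  unfolding ideal_type_algebra_iff
  using ideal_zero[OF J] ideal_add[OF J] ideal_mult[OF J] by (auto simp: distrib_right mult.assoc)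

text \<open>
  The polynomials \<open>h\<close> with \<open>h f \<in> J\<close> form an ideal. It contains all variables, hence also \<open>f\<close>, which
  puts \<open>f\<^sup>2\<close> into \<open>J\<close>.
\<close>

lemma const_free_mem_radical:
  fixes J :: "('s::finite, 'a::field) mvpoly set"
  assumes J: "radical_ideal J" and f: "mv_eval f 0 = 0" and vars: "\<And>i. mv_var i * f \<in> J"
  shows "f \<in> J"
proof -
  have I: "ideal {h. h * f \<in> J} mvpoly_ring"
    using J by (intro colon_ideal) (simp add: radical_ideal_def)
  have "mv_subst mv_const mv_var f - mv_subst mv_const (\<lambda>i. mv_const (0 $ i)) f \<in> {h. h * f \<in> J}"
    by (rule mv_subst_cong_mod_ideal[OF I]) (use vars in simp)
  then have "f ^ 2 \<in> J" 
    unfolding mv_subst_self mv_subst_const_point f by (simp add: power2_eq_square)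
  then show ?thesis using J unfolding radical_ideal_def by (metis zero_less_numeral)
qed

text \<open>
  Modulo \<open>J\<close>, a power of each further variable is a monomial divisible by an earlier variable. So,
  starting from \<open>t\<^sub>0 f\<close>, all products \<open>t\<^sub>j f\<close> lie in the radical ideal \<open>J\<close> one after the other.
\<close>

lemma saturated_mem_radical:
  fixes J :: "('s::finite, 'a::field) mvpoly set"
  assumes J: "radical_ideal J"
    and e: "UNIV = e ` {..<n}"
    and b: "\<And>j. Suc j < n \<Longrightarrow> \<exists>i\<in>e ` {..j}. b j i > 0" "\<And>j. Suc j < n \<Longrightarrow> D j > 0"
      "\<And>j. Suc j < n \<Longrightarrow> mv_var (e (Suc j)) ^ D j - tpow (b j) \<in> J"
    and f: "mv_eval f 0 = 0" "mv_var (e 0) ^ N * f \<in> J"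
  shows "f \<in> J"
proof -
  have I: "ideal J mvpoly_ring" using J by (simp add: radical_ideal_def)
  have "mv_var (e j) * f \<in> J" if "j < n" for j
    using that
  proof (induction j rule: less_induct)
    case (less j)
    show ?case
    proof (cases j)
      case 0
      have "mv_var (e 0) ^ N * f * (mv_var (e 0) * f ^ N) \<in> J"
        using f(2) by (rule ideal_mult_right[OF I])
      then have "(mv_var (e 0) * f) ^ Suc N \<in> J" by (simp add: power_mult_distrib mult_ac)
      then show ?thesis using J 0 unfolding radical_ideal_def by blast
    next
      case (Suc l)
      then obtain i where i: "i \<le> l" "b l (e i) > 0" using b(1)[of l] less.prems by auto
      then have IH: "mv_var (e i) * f \<in> J" using less Suc by simp
      have D: "D l > 0" using b(2) Suc less.prems by simp
      have tb: "tpow (b l) = mv_var (e i) * tpow (\<lambda>x. b l x - (if x = e i then 1 else 0))"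
      proof -
        have "b l = (\<lambda>x. (if x = e i then 1 else 0) + (b l x - (if x = e i then 1 else 0)))"
          using i(2) by auto
        then have "tpow (b l) = tpow (\<lambda>x. (if x = e i then 1 else 0) + (b l x - (if x = e i then 1 else 0)))"
          by simp
        then show ?thesis unfolding tpow_add tpow_var by simp
      qed
      have fD: "f ^ D l = f * f ^ (D l - 1)" using D by (cases "D l") auto
      have "tpow (b l) * f ^ D l =
          mv_var (e i) * f * (tpow (\<lambda>x. b l x - (if x = e i then 1 else 0)) * f ^ (D l - 1))"
        unfolding tb fD by (simp only: mult_ac)
      also have "\<dots> \<in> J" using IH by (rule ideal_mult_right[OF I])
      finally have 1: "tpow (b l) * f ^ D l \<in> J" .
      have "(mv_var (e j) ^ D l - tpow (b l)) * f ^ D l + tpow (b l) * f ^ D l \<in> J"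
        using b(3)[of l] less.prems Suc by (intro ideal_add[OF I] ideal_mult_right[OF I] 1) simp
      then have "(mv_var (e j) * f) ^ D l \<in> J" by (simp add: power_mult_distrib left_diff_distrib)
      then show ?thesis using J D unfolding radical_ideal_def by blast
    qed
  qed
  then have "mv_var i * f \<in> J" for i using e by (metis imageE lessThan_iff UNIV_I)
  then show ?thesis by (rule const_free_mem_radical[OF J f(1)])
qed

theorem corollary3p3:
  fixes v :: "'s::finite \<Rightarrow> nat ^ 'n::finite"
  shows "binomial_set_theoretic_ci
           (vanishing_ideal (toric_set v :: ('a::{field,finite} ^ 's) set set))"
proof -
  define Y :: "('a ^ 's) set" where "Y = torus_points v"
  have nz: "y $ i \<noteq> 0" if "y \<in> Y" for y :: "'a ^ 's" and i using that torus_points_nonzero by (auto simp: Y_def)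
  let ?V = "vanishing_ideal (toric_set v :: ('a ^ 's) set set)"
  define n where "n = CARD('s)"
  have n: "n > 0" by (simp add: n_def)
  obtain e :: "nat \<Rightarrow> 's" where e: "bij_betw e {..<n} UNIV"
    using ex_bij_betw_nat_finite[of "UNIV :: 's set"] by (auto simp: lessThan_atLeast0 n_def)
  have "\<exists>d t b. reducing_binomial Y (e ` {..j}) (e (Suc j)) d t b" for j
    using nz by (rule exists_reducing_binomial[where k = "e 0"]) auto
  then obtain d t b where Q: "\<And>j. reducing_binomial Y (e ` {..j}) (e (Suc j)) (d j) (t j) (b j)"
    by metis
  define D where "D j = d j * CHAR('a) ^ t j" for j
  define G :: "nat \<Rightarrow> ('s, 'a) mvpoly" where "G j = mv_var (e (Suc j)) ^ D j - tpow (b j)" for j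
  have D: "D j > 0" for j
    using Q[of j] prime_CHAR_finite_field[where ?'a = 'a] by (simp add: reducing_binomial_def D_def prime_gt_0_nat)
  let ?I = "Idl\<^bsub>mvpoly_ring\<^esub> (G ` {..<n - 1})"
  define J where "J = rad_ideal mvpoly_ring ?I"
  have J: "radical_ideal J"
    unfolding radical_ideal_def J_def using ideal_rad_ideal[OF genideal_type_ideal] rad_idealD by blast
  have I: "ideal J mvpoly_ring" using J by (simp add: radical_ideal_def)
  have GJ: "G j \<in> J" if "Suc j < n" for j
    unfolding J_def
    by (rule subsetD[OF subset_rad_ideal], rule subsetD[OF genideal_type_self]) (use that in auto)
  have same: "\<exists>N. mv_var (e 0) ^ N * (tpow f - tpow g) \<in> J"
    if "j < n" "\<And>i. i \<notin> e ` {..j} \<Longrightarrow> f i = 0" "\<And>i. i \<notin> e ` {..j} \<Longrightarrow> g i = 0" "same_on Y f g" for j f g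
    using that
  proof (induction j arbitrary: f g)
    case 0
    have "sum f UNIV = f (e 0)" if "\<And>i. i \<noteq> e 0 \<Longrightarrow> f i = 0" for f :: "'s \<Rightarrow> nat"
      using sum.mono_neutral_left[of UNIV "{e 0}" f] that by simp
    then have "f (e 0) = g (e 0)" using 0 by (simp add: same_on_def)
    then have "f = g" using 0 by (intro ext) (metis atMost_0 image_empty image_insert singletonD)
    then show ?case using ideal_zero[OF I] by simp
  next
    case (Suc j)
    have *: "e ` {..Suc j} = insert (e (Suc j)) (e ` {..j})" by (auto simp: atMost_Suc)
    show ?case
    proof (rule extend_same_on[OF nz J Q[of j]])
      show "mv_var (e (Suc j)) ^ (d j * CHAR('a) ^ t j) - tpow (b j) \<in> J"
        using GJ[of j] Suc.prems(1) by (simp add: G_def D_def)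
      show "\<exists>N. mv_var (e 0) ^ N * (tpow f - tpow g) \<in> J"
        if "\<And>i. i \<notin> e ` {..j} \<Longrightarrow> f i = 0" "\<And>i. i \<notin> e ` {..j} \<Longrightarrow> g i = 0" "same_on Y f g" for f g
        using Suc.IH[of f g] Suc.prems(1) that by simp
    qed (use Q[of j] Suc.prems in \<open>auto simp: reducing_binomial_def *\<close>)
  qed
  \<comment> \<open>For the last variable, the condition on the supports is empty.\<close>
  have same': "\<exists>N. mv_var (e 0) ^ N * (tpow f - tpow g) \<in> J" if "same_on Y f g" for f g
  proof (rule same[of "n - 1"])
    have "{..n - 1} = {..<n}" using n by auto
    then have "e ` {..n - 1} = UNIV" using e by (simp add: bij_betw_def)
    then show "i \<notin> e ` {..n - 1} \<Longrightarrow> f i = 0" "i \<notin> e ` {..n - 1} \<Longrightarrow> g i = 0" for i by simp_all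
  qed (use n that in auto)
  have homJ: "f \<in> J" if f: "mv_homogeneous f" "\<forall>y\<in>Y. mv_eval f y = 0" for f
  proof -
    obtain c where c: "homogeneous_deg c f" using f(1) by (auto simp: mv_homogeneous_iff)
    have "\<exists>N. mv_var (e 0) ^ N * f \<in> J"
    proof (rule homogeneous_vanishing_saturated[OF I _ _ same' c])
      show "(\<chi> i. 1) \<in> Y" "\<And>y z. y \<in> Y \<Longrightarrow> z \<in> Y \<Longrightarrow> (\<chi> i. y $ i * z $ i) \<in> Y"
        unfolding Y_def by (fact torus_points_1, fact torus_points_mult)
      show "mv_eval f y = 0" if "y \<in> Y" for y using f(2) that by blast
    qed
    then obtain N where N: "mv_var (e 0) ^ N * f \<in> J" ..
    have "(\<chi> i. 1) \<in> Y" unfolding Y_def by (rule torus_points_1)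
    then have "mv_eval f (\<chi> i. 1) = 0" using f(2) by blast
    then have "mv_eval f (0 *s (\<chi> i. 1)) = 0"
      unfolding mv_eval_scale[OF c[unfolded homogeneous_deg_def]] by simp
    then have f0: "mv_eval f 0 = 0" by simp
    show ?thesis
    proof (rule saturated_mem_radical[OF J _ _ _ _ f0, where e = e and N = N and n = n and b = b and D = D])
      show "UNIV = e ` {..<n}" using e by (simp add: bij_betw_def)
      show "\<exists>i\<in>e ` {..j}. b j i > 0" for j
      proof (rule ccontr)
        assume "\<not> ?thesis"
        then have "b j i = 0" for i
          using Q[of j] by (cases "i \<in> e ` {..j}") (auto simp: reducing_binomial_def)
        then have "sum (b j) UNIV = 0" by simp
        then show False using D[of j] Q[of j] unfolding reducing_binomial_def D_def by simp
      qed
    qed (use N D GJ in \<open>auto simp: G_def\<close>)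
  qed
  have "?V \<subseteq> J"
    unfolding vanishing_ideal_toric using homJ by (intro genideal_type_minimal[OF I]) (auto simp: Y_def)
  then have "rad_ideal mvpoly_ring ?V \<subseteq> J"
    using J unfolding subset_iff mem_rad_ideal_iff radical_ideal_def by blast
  moreover have "G j \<in> ?V" for j
  proof -
    have "homogeneous_deg (D j) (mv_var (e (Suc j)) ^ D j)"
      using homogeneous_deg_tpow[of "\<lambda>i. if i = e (Suc j) then D j else 0"] by (simp add: tpow_var sum.delta)
    moreover have "homogeneous_deg (D j) (tpow (b j))"
      using homogeneous_deg_tpow[of "b j"] Q[of j] by (simp add: reducing_binomial_def D_def)
    ultimately have "mv_homogeneous (G j)"
      unfolding G_def mv_homogeneous_iff by (blast intro: homogeneous_deg_diff)
    moreover have "mv_eval (G j) y = 0" if "y \<in> Y" for y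
      using Q[of j] that mv_eval_tpow[of "b j" y]
      by (simp add: reducing_binomial_def D_def G_def mv_eval_subst mv_subst_diff[OF coeff_hom_id]
          mv_subst_power[OF coeff_hom_id] mv_subst_var[OF coeff_hom_id])
    ultimately show ?thesis
      unfolding vanishing_ideal_toric Y_def[symmetric] by (intro subsetD[OF genideal_type_self]) simp
  qed
  then have "J \<subseteq> rad_ideal mvpoly_ring ?V"
    unfolding J_def
    by (intro rad_ideal_mono genideal_type_minimal) (auto simp: vanishing_ideal_def genideal_type_ideal)
  moreover have "is_binomial (G j)" for j
    unfolding is_binomial_def G_def tpow_var[symmetric] tpow_def by blast
  ultimately show ?thesis
    unfolding binomial_set_theoretic_ci_def J_def
    by (intro exI[of _ "n - 1"] exI[of _ G]) (auto simp: ideal_height_vanishing_ideal n_def)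
qed

end
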